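(* Let $\mathbb{C}$ be an exact category satisfying Condition P. Then every reflexive corelation in $\mathbb{C}$ is a co-effective-equivalence-relation. Moreover, $\mathbb{C}$ is coexact as soon as it admits pushouts of regular epimorphisms along regular epimorphisms.
   Context: A category is regular if it is finitely complete, admits coequalizers of kernel pairs, and its regular epimorphisms are pullback stable. A regular category is exact (in the sense of Barr) if every internal equivalence relation in it is effective, i.e. is the kernel pair of some morphism. A category is coexact if its opposite category is exact. A reflexive corelation on an object $A$ is an object $Q$ with morphisms $q_1,q_2:A\to Q$ such that $[q_1,q_2]:A+A\to Q$ is an epimorphism and there exists $e:Q\to A$ with $e q_1=1_A=e q_2$. It is a co-effective-equivalence-relation if $(Q,q_1,q_2)$ is the cokernel pair of some morphism (i.e. the pushout of that morphism along itself); equivalently, it is an effective equivalence relation in the opposite category. A feeble pullback in a category with finite limits is a commutative square such that the unique induced morphism from its initial corner into the pullback is a regular epimorphism. A category $\mathbb{C}$ with finite limits is said to satisfy Condition P if: (a) finite coproducts exist in $\mathbb{C}$; (b) binary coproducts of pullback squares are pullback squares in $\mathbb{C}$ (that is, given two pullback squares, the square obtained by taking the binary coproduct of corresponding objects and morphisms is a pullback); (c) for each monomorphism $m:S\to A$ in $\mathbb{C}$, the commutative square with top $m+1_S:S+S\to A+S$, left side $[1_S,1_S]:S+S\to S$, right side $[1_A,m]:A+S\to A$ and bottom $m:S\to A$ is a pullback; (d) for each regular epimorphism $p:E\to B$ in $\mathbb{C}$, the commutative square with top $p+p:E+E\to B+B$, left side $[1_E,1_E]:E+E\to E$, right side $[1_B,1_B]:B+B\to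 B$ and bottom $p:E\to B$ is a feeble pullback. *)

theory Defs
  imports Main
begin

text \<open>Only the values on \<open>Obj\<close> and \<open>Arr\<close>, and on composable pairs, are meaningful.\<close>

record ('o, 'm) cat =
  Obj :: "'o set"
  Arr :: "'m set"
  Dom :: "'m \<Rightarrow> 'o"
  Cod :: "'m \<Rightarrow> 'o"
  Ident :: "'o \<Rightarrow> 'm"
  Comp :: "'m \<Rightarrow> 'm \<Rightarrow> 'm"  (infixl "\<cdot>\<index>" 70)

definition hom :: "('o, 'm) cat \<Rightarrow> 'o \<Rightarrow> 'o \<Rightarrow> 'm set" where
  "hom C a b = {f \<in> Arr C. Dom C f = a \<and> Cod C f = b}"

locale category =
  fixes C :: "('o, 'm) cat" (structure)
  assumes dom_obj: "f \<in> Arr C \<Longrightarrow> Dom C f \<in> Obj C"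
    and cod_obj: "f \<in> Arr C \<Longrightarrow> Cod C f \<in> Obj C"
    and id_hom: "a \<in> Obj C \<Longrightarrow> Ident C a \<in> hom C a a"
    and comp_hom: "f \<in> hom C a b \<Longrightarrow> g \<in> hom C b c \<Longrightarrow> g \<cdot> f \<in> hom C a c"
    and comp_id_right: "f \<in> hom C a b \<Longrightarrow> f \<cdot> Ident C a = f"
    and comp_id_left: "f \<in> hom C a b \<Longrightarrow> Ident C b \<cdot> f = f"
    and comp_assoc: "f \<in> hom C a b \<Longrightarrow> g \<in> hom C b c \<Longrightarrow> h \<in> hom C c d \<Longrightarrow>
      (h \<cdot> g) \<cdot> f = h \<cdot> (g \<cdot> f)"

definition op_cat :: "('o, 'm) cat \<Rightarrow> ('o, 'm) cat" where
  "op_cat C = \<lparr>Obj = Obj C, Arr = Arr C, Dom = Cod C, Cod = Dom C, Ident = Ident C,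
     Comp = (\<lambda>g f. f \<cdot>\<^bsub>C\<^esub> g)\<rparr>"

lemma category_op_cat:
  assumes "category C"
  shows "category (op_cat C)"
proof -
  interpret category C by fact
  have comp_closed': "f \<cdot>\<^bsub>C\<^esub> g \<in> Arr C \<and> Dom C (f \<cdot>\<^bsub>C\<^esub> g) = Dom C g \<and> Cod C (f \<cdot>\<^bsub>C\<^esub> g) = Cod C f"
    if "f \<in> Arr C" "g \<in> Arr C" "Cod C g = Dom C f" for f g
    using comp_hom[of g "Dom C g" "Cod C g" f "Cod C f"] that by (auto simp: hom_def)
  show ?thesis
    by unfold_locales
      (auto simp: op_cat_def hom_def
        dest: dom_obj cod_obj id_hom[unfolded hom_def] comp_closed'
        intro: comp_id_left[unfolded hom_def, simplified] comp_id_right[unfolded hom_def, simplified]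
          comp_assoc[unfolded hom_def, simplified, symmetric])
qed


definition mono_arr :: "('o, 'm) cat \<Rightarrow> 'm \<Rightarrow> bool" where
  "mono_arr C m \<longleftrightarrow> m \<in> Arr C \<and>
     (\<forall>u v. u \<in> Arr C \<and> v \<in> Arr C \<and> Dom C u = Dom C v \<and> Cod C u = Dom C m \<and> Cod C v = Dom C m \<and>
        m \<cdot>\<^bsub>C\<^esub> u = m \<cdot>\<^bsub>C\<^esub> v \<longrightarrow> u = v)"

definition epi_arr :: "('o, 'm) cat \<Rightarrow> 'm \<Rightarrow> bool" where
  "epi_arr C e \<longleftrightarrow> e \<in> Arr C \<and>
     (\<forall>u v. u \<in> Arr C \<and> v \<in> Arr C \<and> Cod C u = Cod C v \<and> Dom C u = Cod C e \<and> Dom C v = Cod C e \<and>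
        u \<cdot>\<^bsub>C\<^esub> e = v \<cdot>\<^bsub>C\<^esub> e \<longrightarrow> u = v)"

definition is_coequalizer :: "('o, 'm) cat \<Rightarrow> 'm \<Rightarrow> 'm \<Rightarrow> 'm \<Rightarrow> bool" where
  "is_coequalizer C f g e \<longleftrightarrow>
     f \<in> Arr C \<and> g \<in> Arr C \<and> Dom C f = Dom C g \<and> Cod C f = Cod C g \<and>
     e \<in> Arr C \<and> Dom C e = Cod C f \<and> e \<cdot>\<^bsub>C\<^esub> f = e \<cdot>\<^bsub>C\<^esub> g \<and>
     (\<forall>h \<in> Arr C. Dom C h = Cod C f \<and> h \<cdot>\<^bsub>C\<^esub> f = h \<cdot>\<^bsub>C\<^esub> g \<longrightarrow>
        (\<exists>!k. k \<in> hom C (Cod C e) (Cod C h) \<and> k \<cdot>\<^bsub>C\<^esub> e = h))"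

definition regular_epi :: "('o, 'm) cat \<Rightarrow> 'm \<Rightarrow> bool" where
  "regular_epi C e \<longleftrightarrow> (\<exists>f g. is_coequalizer C f g e)"

text \<open>The arguments of \<open>comm_square C t l r b\<close> and of the predicates on squares below are the top,
  left, right and bottom sides; the initial corner is the domain of \<open>t\<close> and \<open>l\<close>.\<close>

definition comm_square :: "('o, 'm) cat \<Rightarrow> 'm \<Rightarrow> 'm \<Rightarrow> 'm \<Rightarrow> 'm \<Rightarrow> bool" where
  "comm_square C t l r b \<longleftrightarrow>
     t \<in> Arr C \<and> l \<in> Arr C \<and> r \<in> Arr C \<and> b \<in> Arr C \<and>
     Dom C t = Dom C l \<and> Cod C t = Dom C r \<and> Cod C l = Dom C b \<and> Cod C r = Cod C b \<and>
     r \<cdot>\<^bsub>C\<^esub> t = b \<cdot>\<^bsub>C\<^esub> l"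

definition is_pullback :: "('o, 'm) cat \<Rightarrow> 'm \<Rightarrow> 'm \<Rightarrow> 'm \<Rightarrow> 'm \<Rightarrow> bool" where
  "is_pullback C t l r b \<longleftrightarrow> comm_square C t l r b \<and>
     (\<forall>u v. comm_square C u v r b \<longrightarrow>
        (\<exists>!w. w \<in> hom C (Dom C u) (Dom C t) \<and> t \<cdot>\<^bsub>C\<^esub> w = u \<and> l \<cdot>\<^bsub>C\<^esub> w = v))"

definition is_pushout :: "('o, 'm) cat \<Rightarrow> 'm \<Rightarrow> 'm \<Rightarrow> 'm \<Rightarrow> 'm \<Rightarrow> bool" where
  "is_pushout C t l r b \<longleftrightarrow> is_pullback (op_cat C) r b t l"

definition feeble_pullback :: "('o, 'm) cat \<Rightarrow> 'm \<Rightarrow> 'm \<Rightarrow> 'm \<Rightarrow> 'm \<Rightarrow> bool" where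
  "feeble_pullback C t l r b \<longleftrightarrow> comm_square C t l r b \<and>
     (\<exists>p q w. is_pullback C p q r b \<and> w \<in> hom C (Dom C t) (Dom C p) \<and>
        p \<cdot>\<^bsub>C\<^esub> w = t \<and> q \<cdot>\<^bsub>C\<^esub> w = l \<and> regular_epi C w)"

definition is_kernel_pair :: "('o, 'm) cat \<Rightarrow> 'm \<Rightarrow> 'm \<Rightarrow> 'm \<Rightarrow> bool" where
  "is_kernel_pair C f r1 r2 \<longleftrightarrow> is_pullback C r1 r2 f f"

definition is_cokernel_pair :: "('o, 'm) cat \<Rightarrow> 'm \<Rightarrow> 'm \<Rightarrow> 'm \<Rightarrow> bool" where
  "is_cokernel_pair C f q1 q2 \<longleftrightarrow> is_pushout C f f q1 q2"


definition is_functor ::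
  "('i, 'j) cat \<Rightarrow> ('o, 'm) cat \<Rightarrow> ('i \<Rightarrow> 'o) \<Rightarrow> ('j \<Rightarrow> 'm) \<Rightarrow> bool" where
  "is_functor J C Fo Fa \<longleftrightarrow>
     (\<forall>j \<in> Obj J. Fo j \<in> Obj C \<and> Fa (Ident J j) = Ident C (Fo j)) \<and>
     (\<forall>h \<in> Arr J. Fa h \<in> hom C (Fo (Dom J h)) (Fo (Cod J h))) \<and>
     (\<forall>h \<in> Arr J. \<forall>k \<in> Arr J. Cod J h = Dom J k \<longrightarrow> Fa (k \<cdot>\<^bsub>J\<^esub> h) = Fa k \<cdot>\<^bsub>C\<^esub> Fa h)"

definition is_cone ::
  "('i, 'j) cat \<Rightarrow> ('o, 'm) cat \<Rightarrow> ('i \<Rightarrow> 'o) \<Rightarrow> ('j \<Rightarrow> 'm) \<Rightarrow> 'o \<Rightarrow> ('i \<Rightarrow> 'm) \<Rightarrow> bool" where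
  "is_cone J C Fo Fa X \<phi> \<longleftrightarrow> X \<in> Obj C \<and>
     (\<forall>j \<in> Obj J. \<phi> j \<in> hom C X (Fo j)) \<and>
     (\<forall>h \<in> Arr J. Fa h \<cdot>\<^bsub>C\<^esub> \<phi> (Dom J h) = \<phi> (Cod J h))"

definition is_limit ::
  "('i, 'j) cat \<Rightarrow> ('o, 'm) cat \<Rightarrow> ('i \<Rightarrow> 'o) \<Rightarrow> ('j \<Rightarrow> 'm) \<Rightarrow> 'o \<Rightarrow> ('i \<Rightarrow> 'm) \<Rightarrow> bool" where
  "is_limit J C Fo Fa X \<phi> \<longleftrightarrow> is_cone J C Fo Fa X \<phi> \<and>
     (\<forall>Y \<psi>. is_cone J C Fo Fa Y \<psi> \<longrightarrow>
        (\<exists>!u. u \<in> hom C Y X \<and> (\<forall>j \<in> Obj J. \<phi> j \<cdot>\<^bsub>C\<^esub> u = \<psi> j)))"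

text \<open>Every finite category is isomorphic to one whose objects and arrows are natural numbers,
  so these shapes give all finite limits.\<close>

definition finitely_complete :: "('o, 'm) cat \<Rightarrow> bool" where
  "finitely_complete C \<longleftrightarrow>
     (\<forall>(J :: (nat, nat) cat) Fo Fa.
        category J \<and> finite (Obj J) \<and> finite (Arr J) \<and> is_functor J C Fo Fa \<longrightarrow>
        (\<exists>X \<phi>. is_limit J C Fo Fa X \<phi>))"


definition regular_category :: "('o, 'm) cat \<Rightarrow> bool" where
  "regular_category C \<longleftrightarrow> category C \<and> finitely_complete C \<and>
     (\<forall>f r1 r2. is_kernel_pair C f r1 r2 \<longrightarrow> (\<exists>e. is_coequalizer C r1 r2 e)) \<and>
     (\<forall>t l r b. is_pullback C t l r b \<and> regular_epi C r \<longrightarrow> regular_epi C l)"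

definition jointly_monic :: "('o, 'm) cat \<Rightarrow> 'm \<Rightarrow> 'm \<Rightarrow> bool" where
  "jointly_monic C r1 r2 \<longleftrightarrow> r1 \<in> Arr C \<and> r2 \<in> Arr C \<and> Dom C r1 = Dom C r2 \<and>
     (\<forall>u v. u \<in> Arr C \<and> v \<in> Arr C \<and> Dom C u = Dom C v \<and> Cod C u = Dom C r1 \<and> Cod C v = Dom C r1 \<and>
        r1 \<cdot>\<^bsub>C\<^esub> u = r1 \<cdot>\<^bsub>C\<^esub> v \<and> r2 \<cdot>\<^bsub>C\<^esub> u = r2 \<cdot>\<^bsub>C\<^esub> v \<longrightarrow> u = v)"

text \<open>In the last clause \<open>p\<close> and \<open>q\<close> are the projections of the object \<open>R \<times>\<^sub>A R\<close> of composable
  pairs.\<close>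

definition internal_equivalence_relation ::
  "('o, 'm) cat \<Rightarrow> 'o \<Rightarrow> 'o \<Rightarrow> 'm \<Rightarrow> 'm \<Rightarrow> bool" where
  "internal_equivalence_relation C A R r1 r2 \<longleftrightarrow>
     r1 \<in> hom C R A \<and> r2 \<in> hom C R A \<and> jointly_monic C r1 r2 \<and>
     (\<exists>d \<in> hom C A R. r1 \<cdot>\<^bsub>C\<^esub> d = Ident C A \<and> r2 \<cdot>\<^bsub>C\<^esub> d = Ident C A) \<and>
     (\<exists>s \<in> hom C R R. r1 \<cdot>\<^bsub>C\<^esub> s = r2 \<and> r2 \<cdot>\<^bsub>C\<^esub> s = r1) \<and>
     (\<forall>p q. is_pullback C p q r2 r1 \<longrightarrow>
        (\<exists>t \<in> hom C (Dom C p) R. r1 \<cdot>\<^bsub>C\<^esub> t = r1 \<cdot>\<^bsub>C\<^esub> p \<and> r2 \<cdot>\<^bsub>C\<^esub> t = r2 \<cdot>\<^bsub>C\<^esub> q))"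

definition exact_category :: "('o, 'm) cat \<Rightarrow> bool" where
  "exact_category C \<longleftrightarrow> regular_category C \<and>
     (\<forall>A R r1 r2. internal_equivalence_relation C A R r1 r2 \<longrightarrow> (\<exists>f. is_kernel_pair C f r1 r2))"

definition coexact_category :: "('o, 'm) cat \<Rightarrow> bool" where
  "coexact_category C \<longleftrightarrow> exact_category (op_cat C)"


definition has_finite_coproducts :: "('o, 'm) cat \<Rightarrow> bool" where
  "has_finite_coproducts C \<longleftrightarrow>
     (\<forall>(I :: nat set) A. finite I \<and> (\<forall>i \<in> I. A i \<in> Obj C) \<longrightarrow>
        (\<exists>S \<in> Obj C. \<exists>\<iota>. (\<forall>i \<in> I. \<iota> i \<in> hom C (A i) S) \<and>
           (\<forall>X \<in> Obj C. \<forall>f. (\<forall>i \<in> I. f i \<in> hom C (A i) X) \<longrightarrow>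
              (\<exists>!h. h \<in> hom C S X \<and> (\<forall>i \<in> I. h \<cdot>\<^bsub>C\<^esub> \<iota> i = f i)))))"

definition is_coproduct :: "('o, 'm) cat \<Rightarrow> 'o \<Rightarrow> 'o \<Rightarrow> 'o \<Rightarrow> 'm \<Rightarrow> 'm \<Rightarrow> bool" where
  "is_coproduct C A B S i j \<longleftrightarrow> S \<in> Obj C \<and> i \<in> hom C A S \<and> j \<in> hom C B S \<and>
     (\<forall>X \<in> Obj C. \<forall>f \<in> hom C A X. \<forall>g \<in> hom C B X.
        (\<exists>!h. h \<in> hom C S X \<and> h \<cdot>\<^bsub>C\<^esub> i = f \<and> h \<cdot>\<^bsub>C\<^esub> j = g))"

text \<open>An arbitrary choice of binary coproducts; it is meaningful only where they exist, and nothing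
  below depends on the choice up to isomorphism.\<close>

definition coprod_cocone :: "('o, 'm) cat \<Rightarrow> 'o \<Rightarrow> 'o \<Rightarrow> 'o \<times> 'm \<times> 'm" where
  "coprod_cocone C A B = (SOME (S, i, j). is_coproduct C A B S i j)"

definition coprod :: "('o, 'm) cat \<Rightarrow> 'o \<Rightarrow> 'o \<Rightarrow> 'o" where
  "coprod C A B = fst (coprod_cocone C A B)"

definition inj_left :: "('o, 'm) cat \<Rightarrow> 'o \<Rightarrow> 'o \<Rightarrow> 'm" where
  "inj_left C A B = fst (snd (coprod_cocone C A B))"

definition inj_right :: "('o, 'm) cat \<Rightarrow> 'o \<Rightarrow> 'o \<Rightarrow> 'm" where
  "inj_right C A B = snd (snd (coprod_cocone C A B))"

text \<open>\<open>copair C f g\<close> is \<open>[f, g]\<close> and \<open>coprod_arr C f g\<close> is \<open>f + g\<close>.\<close>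

definition copair :: "('o, 'm) cat \<Rightarrow> 'm \<Rightarrow> 'm \<Rightarrow> 'm" where
  "copair C f g = (THE h. h \<in> hom C (coprod C (Dom C f) (Dom C g)) (Cod C f) \<and>
     h \<cdot>\<^bsub>C\<^esub> inj_left C (Dom C f) (Dom C g) = f \<and> h \<cdot>\<^bsub>C\<^esub> inj_right C (Dom C f) (Dom C g) = g)"

definition coprod_arr :: "('o, 'm) cat \<Rightarrow> 'm \<Rightarrow> 'm \<Rightarrow> 'm" where
  "coprod_arr C f g = copair C (inj_left C (Cod C f) (Cod C g) \<cdot>\<^bsub>C\<^esub> f)
     (inj_right C (Cod C f) (Cod C g) \<cdot>\<^bsub>C\<^esub> g)"

definition condition_P :: "('o, 'm) cat \<Rightarrow> bool" where
  "condition_P C \<longleftrightarrow> category C \<and> finitely_complete C \<and>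
     has_finite_coproducts C \<and>
     (\<forall>t l r b t' l' r' b'. is_pullback C t l r b \<and> is_pullback C t' l' r' b' \<longrightarrow>
        is_pullback C (coprod_arr C t t') (coprod_arr C l l')
          (coprod_arr C r r') (coprod_arr C b b')) \<and>
     (\<forall>S A m. m \<in> hom C S A \<and> mono_arr C m \<longrightarrow>
        is_pullback C (coprod_arr C m (Ident C S)) (copair C (Ident C S) (Ident C S))
          (copair C (Ident C A) m) m) \<and>
     (\<forall>E B p. p \<in> hom C E B \<and> regular_epi C p \<longrightarrow>
        feeble_pullback C (coprod_arr C p p) (copair C (Ident C E) (Ident C E))
          (copair C (Ident C B) (Ident C B)) p)"

definition reflexive_corelation :: "('o, 'm) cat \<Rightarrow> 'o \<Rightarrow> 'o \<Rightarrow> 'm \<Rightarrow> 'm \<Rightarrow> bool" where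
  "reflexive_corelation C A Q q1 q2 \<longleftrightarrow> q1 \<in> hom C A Q \<and> q2 \<in> hom C A Q \<and>
     epi_arr C (copair C q1 q2) \<and>
     (\<exists>e \<in> hom C Q A. e \<cdot>\<^bsub>C\<^esub> q1 = Ident C A \<and> e \<cdot>\<^bsub>C\<^esub> q2 = Ident C A)"

definition coeffective_equivalence_relation ::
  "('o, 'm) cat \<Rightarrow> 'o \<Rightarrow> 'o \<Rightarrow> 'm \<Rightarrow> 'm \<Rightarrow> bool" where
  "coeffective_equivalence_relation C A Q q1 q2 \<longleftrightarrow> q1 \<in> hom C A Q \<and> q2 \<in> hom C A Q \<and>
     (\<exists>f. is_cokernel_pair C f q1 q2)"

definition has_pushouts_of_regular_epis :: "('o, 'm) cat \<Rightarrow> bool" where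
  "has_pushouts_of_regular_epis C \<longleftrightarrow>
     (\<forall>f g. regular_epi C f \<and> regular_epi C g \<and> Dom C f = Dom C g \<longrightarrow>
        (\<exists>r b. is_pushout C f g r b))"

end

theory Submission imports Defs begin

text \<open>Arguments are phrased with generalized elements, and regular epimorphisms serve as covers on which
  equalities and factorizations through monomorphisms may be checked. Condition P computes pullbacks of
  copairs: exactly along a monomorphism, by (b) and (c), and up to a cover along a regular epimorphism, by
  (b) and (d).

  Let \<open>m : S \<rightarrow> A\<close> be mono and \<open>p : S \<rightarrow> B\<close> a regular epimorphism with kernel pair \<open>n1, n2 : N \<rightarrow> S\<close>. These
  computations show that the image of \<open>[1, m n1], [1, m n2] : A + N \<rightarrow> A\<close> is an equivalence relation on
  \<open>A\<close>. By exactness it has an effective quotient, which is the pushout of \<open>m\<close> along \<open>p\<close>, and there \<open>B\<close>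
  remains a subobject. Applied to \<open>m + m\<close> and the codiagonal of \<open>S\<close>, this is the cokernel pair of \<open>m\<close>,
  and \<open>m\<close> turns out to be its equalizer; hence all epimorphisms are regular. For a reflexive corelation
  \<open>q1, q2\<close>, the kernel pair of the regular epimorphism \<open>[q1, q2]\<close> is then covered by the pullbacks of
  \<open>[q1, q2]\<close> along \<open>q1\<close> and \<open>q2\<close>, which are described by the equalizer \<open>k\<close> of \<open>q1\<close> and \<open>q2\<close>; so \<open>Q\<close> is the
  cokernel pair of \<open>k\<close>.

  For coexactness, the coequalizer of \<open>f, g\<close> is obtained by pushing out the regular epi part of \<open>[f, g]\<close>
  along the codiagonal, and pushing out the result, again a regular epimorphism, along the mono part.\<close>

section \<open>Arrows, coproducts and finite limits\<close>

context category
begin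

lemma hom_iff [simp]: "f \<in> hom C a b \<longleftrightarrow> f \<in> Arr C \<and> Dom C f = a \<and> Cod C f = b"
  by (simp add: hom_def)

lemma dom_cod_obj [simp]:
  assumes "f \<in> Arr C"
  shows "Dom C f \<in> Obj C" "Cod C f \<in> Obj C"
  using assms dom_obj cod_obj by auto

lemma comp_arr [simp]:
  assumes "f \<in> Arr C" "g \<in> Arr C" "Cod C f = Dom C g"
  shows "g \<cdot> f \<in> Arr C" "Dom C (g \<cdot> f) = Dom C f" "Cod C (g \<cdot> f) = Cod C g"
  using comp_hom[of f "Dom C f" "Cod C f" g "Cod C g"] assms by auto

lemma ident_arr [simp]:
  assumes "a \<in> Obj C"
  shows "Ident C a \<in> Arr C" "Dom C (Ident C a) = a" "Cod C (Ident C a) = a"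
  using id_hom[OF assms] by auto

lemma comp_ident [simp]:
  "f \<in> Arr C \<Longrightarrow> Dom C f = a \<Longrightarrow> f \<cdot> Ident C a = f"
  "f \<in> Arr C \<Longrightarrow> Cod C f = a \<Longrightarrow> Ident C a \<cdot> f = f"
  using comp_id_left comp_id_right by auto

lemma assoc [simp]:
  assumes "f \<in> Arr C" "g \<in> Arr C" "h \<in> Arr C" "Cod C f = Dom C g" "Cod C g = Dom C h"
  shows "(h \<cdot> g) \<cdot> f = h \<cdot> (g \<cdot> f)"
  using comp_assoc[of f "Dom C f" "Dom C g" g "Dom C h" h "Cod C h"] assms by simp

text \<open>Composites are normalized by nesting to the right, so an equation
  \<open>g \<cdot> f = h\<close> no longer matches inside \<open>g \<cdot> (f \<cdot> x)\<close>;
  this supplies the form that does.\<close>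

lemma reassoc:
  assumes "g \<cdot> f = h" "f \<in> Arr C" "g \<in> Arr C" "Cod C f = Dom C g" "x \<in> Arr C" "Cod C x = Dom C f"
  shows "g \<cdot> (f \<cdot> x) = h \<cdot> x"
  using assms(2-) by (simp add: assms(1)[symmetric])

lemma monoD:
  assumes "mono_arr C m" "m \<cdot> u = m \<cdot> v" "u \<in> Arr C" "v \<in> Arr C" "Dom C u = Dom C v"
    "Cod C u = Dom C m" "Cod C v = Dom C m"
  shows "u = v"
  using assms unfolding mono_arr_def by blast

lemma epiD:
  assumes "epi_arr C e" "u \<cdot> e = v \<cdot> e" "u \<in> Arr C" "v \<in> Arr C" "Cod C u = Cod C v"
    "Dom C u = Cod C e" "Dom C v = Cod C e"
  shows "u = v"
  using assms unfolding epi_arr_def by blast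

lemma split_mono:
  assumes "e \<cdot> m = Ident C (Dom C m)" "e \<in> Arr C" "m \<in> Arr C" "Cod C m = Dom C e"
  shows "mono_arr C m"
  unfolding mono_arr_def
proof (intro conjI allI impI)
  fix u v assume uv: "u \<in> Arr C \<and> v \<in> Arr C \<and> Dom C u = Dom C v \<and> Cod C u = Dom C m \<and> Cod C v = Dom C m \<and>
    m \<cdot> u = m \<cdot> v"
  then have "(e \<cdot> m) \<cdot> u = (e \<cdot> m) \<cdot> v" using assms(2-) by simp
  with uv assms show "u = v" by simp
qed (use assms in simp)

text \<open>A split epimorphism is the coequalizer of the idempotent \<open>s \<cdot> p\<close> and
  the identity.\<close>

lemma split_epi_regular:
  assumes "p \<cdot> s = Ident C (Cod C p)" "p \<in> Arr C" "s \<in> Arr C" "Cod C s = Dom C p" "Dom C s = Cod C p"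
  shows "regular_epi C p"
proof -
  have "is_coequalizer C (s \<cdot> p) (Ident C (Dom C p)) p"
    unfolding is_coequalizer_def
  proof (intro conjI ballI impI)
    fix h assume h: "h \<in> Arr C"
      "Dom C h = Cod C (s \<cdot> p) \<and> h \<cdot> (s \<cdot> p) = h \<cdot> Ident C (Dom C p)"
    show "\<exists>!k. k \<in> hom C (Cod C p) (Cod C h) \<and> k \<cdot> p = h"
    proof (rule ex1I[of _ "h \<cdot> s"])
      fix k assume "k \<in> hom C (Cod C p) (Cod C h) \<and> k \<cdot> p = h"
      then show "k = h \<cdot> s" using assms h by auto
    qed (use assms h in auto)
  qed (use assms reassoc[OF assms(1), of p] in auto)
  then show ?thesis unfolding regular_epi_def by blast
qed

lemma coequalizerE:
  assumes "is_coequalizer C f g e" "h \<in> Arr C" "Dom C h = Dom C e" "h \<cdot> f = h \<cdot> g"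
  obtains k where "k \<in> Arr C" "Dom C k = Cod C e" "Cod C k = Cod C h" "k \<cdot> e = h"
  using assms unfolding is_coequalizer_def by (auto dest!: bspec[of _ _ h])

lemma coequalizer_epi:
  assumes "is_coequalizer C f g e"
  shows "epi_arr C e"
  unfolding epi_arr_def
proof (intro conjI allI impI)
  show "e \<in> Arr C" using assms by (simp add: is_coequalizer_def)
  fix u v assume uv: "u \<in> Arr C \<and> v \<in> Arr C \<and> Cod C u = Cod C v \<and> Dom C u = Cod C e \<and> Dom C v = Cod C e \<and>
    u \<cdot> e = v \<cdot> e"
  have e: "f \<in> Arr C" "g \<in> Arr C" "e \<in> Arr C" "Cod C f = Dom C e" "Cod C g = Dom C e" "e \<cdot> f = e \<cdot> g"
    using assms by (auto simp: is_coequalizer_def)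
  have "u \<cdot> e \<in> Arr C \<and> Dom C (u \<cdot> e) = Cod C f \<and> (u \<cdot> e) \<cdot> f = (u \<cdot> e) \<cdot> g"
    using e uv by simp
  then have "\<exists>!k. k \<in> hom C (Cod C e) (Cod C (u \<cdot> e)) \<and> k \<cdot> e = u \<cdot> e"
    using assms unfolding is_coequalizer_def by blast
  moreover have "u \<in> hom C (Cod C e) (Cod C (u \<cdot> e))" "v \<in> hom C (Cod C e) (Cod C (u \<cdot> e))" "v \<cdot> e = u \<cdot> e"
    using e uv by simp_all
  ultimately show "u = v" by blast
qed

lemma regular_epi_epi: "regular_epi C e \<Longrightarrow> epi_arr C e"
  unfolding regular_epi_def using coequalizer_epi by blast

lemma regular_epi_arr: "regular_epi C e \<Longrightarrow> e \<in> Arr C"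
  using regular_epi_epi by (simp add: epi_arr_def)

text \<open>Diagonal fill-in: since \<open>m\<close> is mono, \<open>y\<close> coequalizes the pair
  that defines \<open>e\<close>, so \<open>y\<close> factors as \<open>z \<cdot> e\<close>;
  cancelling \<open>e\<close> gives \<open>m \<cdot> z = x\<close>.\<close>

lemma regular_epi_fill:
  assumes e: "regular_epi C e" and m: "mono_arr C m" and "x \<in> Arr C" "y \<in> Arr C"
    "Cod C e = Dom C x" "Cod C y = Dom C m" "Cod C x = Cod C m" "x \<cdot> e = m \<cdot> y" "Dom C e = Dom C y"
  obtains z where "z \<in> Arr C" "Dom C z = Dom C x" "Cod C z = Dom C m" "m \<cdot> z = x"
proof -
  obtain f g where fg: "is_coequalizer C f g e" using e unfolding regular_epi_def by blast
  have mA: "m \<in> Arr C" using m by (simp add: mono_arr_def)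
  have fg': "f \<in> Arr C" "g \<in> Arr C" "e \<in> Arr C" "Dom C f = Dom C g" "Cod C f = Dom C e"
    "Cod C g = Dom C e" "e \<cdot> f = e \<cdot> g"
    using fg by (auto simp: is_coequalizer_def)
  have "m \<cdot> (y \<cdot> f) = x \<cdot> (e \<cdot> f)" "m \<cdot> (y \<cdot> g) = x \<cdot> (e \<cdot> g)"
    using fg'(1-6) assms(3-) mA reassoc[OF assms(8), of f] reassoc[OF assms(8), of g] by simp_all
  then have "m \<cdot> (y \<cdot> f) = m \<cdot> (y \<cdot> g)" using fg' by simp
  then have "y \<cdot> f = y \<cdot> g" using m mA fg' assms by - (rule monoD[OF m], auto)
  with fg obtain z where z: "z \<in> Arr C" "Dom C z = Cod C e" "Cod C z = Cod C y" "z \<cdot> e = y"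
    using assms by (elim coequalizerE[where h = y]) auto
  have "m \<cdot> z = x"
  proof (rule epiD[OF regular_epi_epi[OF e]])
    show "(m \<cdot> z) \<cdot> e = x \<cdot> e" using z assms mA fg' by simp
  qed (use z assms mA in auto)
  with z assms show thesis by (intro that[of z]) auto
qed

lemma pullbackD:
  assumes "is_pullback C t l r b"
  shows "t \<in> Arr C" "l \<in> Arr C" "r \<in> Arr C" "b \<in> Arr C" "Dom C t = Dom C l" "Cod C t = Dom C r"
    "Cod C l = Dom C b" "Cod C r = Cod C b" "r \<cdot> t = b \<cdot> l"
  using assms unfolding is_pullback_def comm_square_def by auto

lemma pullbackE:
  assumes "is_pullback C t l r b" "u \<in> Arr C" "v \<in> Arr C" "Dom C u = Dom C v" "Cod C u = Dom C r"
    "Cod C v = Dom C b" "r \<cdot> u = b \<cdot> v"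
  obtains w where "w \<in> Arr C" "Dom C w = Dom C u" "Cod C w = Dom C l" "t \<cdot> w = u" "l \<cdot> w = v"
proof -
  have "comm_square C u v r b" using assms pullbackD[OF assms(1)] by (simp add: comm_square_def)
  with assms(1) obtain w where "w \<in> hom C (Dom C u) (Dom C t) \<and> t \<cdot> w = u \<and> l \<cdot> w = v"
    unfolding is_pullback_def by blast
  with that pullbackD[OF assms(1)] show thesis by auto
qed

lemma pullback_eq:
  assumes pb: "is_pullback C t l r b" and "u \<in> Arr C" "v \<in> Arr C" "Dom C u = Dom C v"
    "Cod C u = Dom C t" "Cod C v = Dom C t" "t \<cdot> u = t \<cdot> v" "l \<cdot> u = l \<cdot> v"
  shows "u = v"
proof -
  note pbD = pullbackD[OF pb]
  have "comm_square C (t \<cdot> u) (l \<cdot> u) r b"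
    using assms pbD reassoc[OF pbD(9), of u] by (simp add: comm_square_def)
  then have "\<exists>!w. w \<in> hom C (Dom C (t \<cdot> u)) (Dom C t) \<and> t \<cdot> w = t \<cdot> u \<and> l \<cdot> w = l \<cdot> u"
    using pb unfolding is_pullback_def by blast
  with assms pbD show ?thesis by auto
qed

lemma pullbackI:
  assumes "t \<in> Arr C" "l \<in> Arr C" "r \<in> Arr C" "b \<in> Arr C" "Dom C t = Dom C l" "Cod C t = Dom C r"
    "Cod C l = Dom C b" "Cod C r = Cod C b" "r \<cdot> t = b \<cdot> l"
  and ex: "\<And>u v. u \<in> Arr C \<Longrightarrow> v \<in> Arr C \<Longrightarrow> Dom C u = Dom C v \<Longrightarrow> Cod C u = Dom C r \<Longrightarrow>
    Cod C v = Dom C b \<Longrightarrow> r \<cdot> u = b \<cdot> v \<Longrightarrow>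
    \<exists>w. w \<in> hom C (Dom C u) (Dom C t) \<and> t \<cdot> w = u \<and> l \<cdot> w = v"
  and uniq: "\<And>w w'. w \<in> Arr C \<Longrightarrow> w' \<in> Arr C \<Longrightarrow> Dom C w = Dom C w' \<Longrightarrow> Cod C w = Dom C t \<Longrightarrow>
    Cod C w' = Dom C t \<Longrightarrow> t \<cdot> w = t \<cdot> w' \<Longrightarrow> l \<cdot> w = l \<cdot> w' \<Longrightarrow> w = w'"
  shows "is_pullback C t l r b"
  unfolding is_pullback_def
proof (intro conjI allI impI)
  show "comm_square C t l r b" using assms(1-9) by (simp add: comm_square_def)
  fix u v assume uv: "comm_square C u v r b"
  then obtain w where w: "w \<in> hom C (Dom C u) (Dom C t) \<and> t \<cdot> w = u \<and> l \<cdot> w = v"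
    using ex[of u v] unfolding comm_square_def by blast
  show "\<exists>!w. w \<in> hom C (Dom C u) (Dom C t) \<and> t \<cdot> w = u \<and> l \<cdot> w = v"
  proof (rule ex1I)
    show "w \<in> hom C (Dom C u) (Dom C t) \<and> t \<cdot> w = u \<and> l \<cdot> w = v" by fact
    fix w' assume "w' \<in> hom C (Dom C u) (Dom C t) \<and> t \<cdot> w' = u \<and> l \<cdot> w' = v"
    with w show "w' = w" by - (rule uniq, auto)
  qed
qed

lemma ex_pullback:
  assumes fc: "finitely_complete C" and fg: "f \<in> Arr C" "g \<in> Arr C" "Cod C f = Cod C g"
  obtains p q where "is_pullback C p q f g"
proof -
  \<comment> \<open>The cospan shape: arrow 4 goes from 0 to 3, arrow 5 from 2 to 3, and each of 0,
    2, 3 is an object and at the same time its own identity. In a composable pair at least one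
    factor is an identity, which gives \<open>Comp\<close>.\<close>
  define J :: "(nat, nat) cat" where "J = \<lparr>Obj = {0, 2, 3}, Arr = {0, 2, 3, 4, 5},
    Dom = (\<lambda>h. if h = 4 then 0 else if h = 5 then 2 else h), Cod = (\<lambda>h. if h = 4 \<or> h = 5 then 3 else h),
    Ident = (\<lambda>i. i), Comp = (\<lambda>h k. if h = 4 \<or> h = 5 then h else k)\<rparr>"
  define Fo where "Fo = (\<lambda>i :: nat. if i = 0 then Dom C f else if i = 2 then Dom C g else Cod C f)"
  define Fa where "Fa = (\<lambda>h :: nat. if h = 4 then f else if h = 5 then g else Ident C (Fo h))"
  have catJ: "category J"
    by unfold_locales (auto simp: J_def hom_def split: if_splits)
  have "is_functor J C Fo Fa"
    using fg unfolding is_functor_def by (auto simp: J_def Fo_def Fa_def)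
  with catJ fc obtain X \<phi> where lim: "is_limit J C Fo Fa X \<phi>"
    unfolding finitely_complete_def by (force simp: J_def)
  then have cone: "is_cone J C Fo Fa X \<phi>" by (simp add: is_limit_def)
  have \<phi>: "\<phi> 0 \<in> hom C X (Dom C f)" "\<phi> 2 \<in> hom C X (Dom C g)" "\<phi> 3 \<in> hom C X (Cod C f)"
    "f \<cdot> \<phi> 0 = \<phi> 3" "g \<cdot> \<phi> 2 = \<phi> 3" "X \<in> Obj C"
    using cone unfolding is_cone_def J_def Fo_def Fa_def by auto
  have "is_pullback C (\<phi> 0) (\<phi> 2) f g"
  proof (rule pullbackI)
    fix u v assume uv: "u \<in> Arr C" "v \<in> Arr C" "Dom C u = Dom C v" "Cod C u = Dom C f"
      "Cod C v = Dom C g" "f \<cdot> u = g \<cdot> v"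
    define \<psi> where "\<psi> = (\<lambda>i :: nat. if i = 0 then u else if i = 2 then v else f \<cdot> u)"
    have "is_cone J C Fo Fa (Dom C u) \<psi>"
      using uv fg unfolding is_cone_def by (auto simp: J_def Fo_def Fa_def \<psi>_def)
    then obtain w where "w \<in> hom C (Dom C u) X" "\<forall>j\<in>Obj J. \<phi> j \<cdot> w = \<psi> j"
      using lim unfolding is_limit_def by blast
    then show "\<exists>w. w \<in> hom C (Dom C u) (Dom C (\<phi> 0)) \<and> \<phi> 0 \<cdot> w = u \<and> \<phi> 2 \<cdot> w = v"
      using \<phi> uv by (auto simp: J_def \<psi>_def)
  next
    fix w w' assume w: "w \<in> Arr C" "w' \<in> Arr C" "Dom C w = Dom C w'" "Cod C w = Dom C (\<phi> 0)"
      "Cod C w' = Dom C (\<phi> 0)" and ww': "\<phi> 0 \<cdot> w = \<phi> 0 \<cdot> w'" "\<phi> 2 \<cdot> w = \<phi> 2 \<cdot> w'"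
    have "is_cone J C Fo Fa (Dom C w) (\<lambda>j. \<phi> j \<cdot> w)"
      using \<phi> w fg unfolding is_cone_def
      by (auto simp: J_def Fo_def Fa_def reassoc[OF \<phi>(4)] reassoc[OF \<phi>(5)])
    then have "\<exists>!u. u \<in> hom C (Dom C w) X \<and> (\<forall>j\<in>Obj J. \<phi> j \<cdot> u = \<phi> j \<cdot> w)"
      using lim unfolding is_limit_def by blast
    moreover have "\<phi> 3 \<cdot> w' = \<phi> 3 \<cdot> w"
      using \<phi> w fg ww' reassoc[OF \<phi>(4), of w] reassoc[OF \<phi>(4), of w'] by simp
    ultimately show "w = w'" using w ww' \<phi> by (auto simp: J_def)
  qed (use \<phi> fg in auto)
  with that show thesis .
qed

lemma ex_product:
  assumes fc: "finitely_complete C" and A: "A \<in> Obj C" and B: "B \<in> Obj C"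
  obtains p q where "p \<in> Arr C" "q \<in> Arr C" "Dom C p = Dom C q" "Cod C p = A" "Cod C q = B"
    "\<And>u v. u \<in> Arr C \<Longrightarrow> v \<in> Arr C \<Longrightarrow> Dom C u = Dom C v \<Longrightarrow> Cod C u = A \<Longrightarrow> Cod C v = B \<Longrightarrow>
      \<exists>w. w \<in> hom C (Dom C u) (Dom C p) \<and> p \<cdot> w = u \<and> q \<cdot> w = v"
    "\<And>w w'. w \<in> Arr C \<Longrightarrow> w' \<in> Arr C \<Longrightarrow> Dom C w = Dom C w' \<Longrightarrow> Cod C w = Dom C p \<Longrightarrow>
      Cod C w' = Dom C p \<Longrightarrow> p \<cdot> w = p \<cdot> w' \<Longrightarrow> q \<cdot> w = q \<cdot> w' \<Longrightarrow> w = w'"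
proof -
  define J :: "(nat, nat) cat" where "J = \<lparr>Obj = {}, Arr = {}, Dom = (\<lambda>h. h), Cod = (\<lambda>h. h),
    Ident = (\<lambda>i. i), Comp = (\<lambda>h k. k)\<rparr>"
  have catJ: "category J" by unfold_locales (auto simp: J_def hom_def)
  \<comment> \<open>The shape is empty, so \<open>A\<close> and \<open>Ident C A\<close> are mere
    placeholder values. The limit is a terminal object, and the product is the pullback over
    it.\<close>
  have "is_functor J C (\<lambda>_. A) (\<lambda>_. Ident C A)"
    unfolding is_functor_def by (auto simp: J_def)
  with catJ fc obtain T \<phi> where lim: "is_limit J C (\<lambda>_. A) (\<lambda>_. Ident C A) T \<phi>"
    unfolding finitely_complete_def by (force simp: J_def)
  then have T: "T \<in> Obj C" "\<And>X. X \<in> Obj C \<Longrightarrow> \<exists>!u. u \<in> hom C X T"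
    unfolding is_limit_def is_cone_def by (auto simp: J_def)
  obtain a b where ab: "a \<in> hom C A T" "b \<in> hom C B T" using T(2) A B by blast
  then obtain p q where pb: "is_pullback C p q a b" using ex_pullback[OF fc, of a b] by auto
  note pbD = pullbackD[OF pb]
  show thesis
  proof (rule that[of p q])
    fix u v assume uv: "u \<in> Arr C" "v \<in> Arr C" "Dom C u = Dom C v" "Cod C u = A" "Cod C v = B"
    have "a \<cdot> u = b \<cdot> v" using uv ab T(2)[of "Dom C u"] dom_obj[of u] by auto
    then show "\<exists>w. w \<in> hom C (Dom C u) (Dom C p) \<and> p \<cdot> w = u \<and> q \<cdot> w = v"
      using uv ab pbD by (elim pullbackE[OF pb, of u v]) auto
  next
    fix w w' assume "w \<in> Arr C" "w' \<in> Arr C" "Dom C w = Dom C w'" "Cod C w = Dom C p"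
      "Cod C w' = Dom C p" "p \<cdot> w = p \<cdot> w'" "q \<cdot> w = q \<cdot> w'"
    then show "w = w'" by (rule pullback_eq[OF pb])
  qed (use pbD ab in auto)
qed

text \<open>Coproducts are assumed for families indexed by finite sets of numbers; the family over
  \<open>{0, 1}\<close> shows that the choice made in \<open>coprod_cocone\<close> is a genuine
  coproduct.\<close>

lemma ex_coprod:
  assumes fc: "has_finite_coproducts C" and A: "A \<in> Obj C" and B: "B \<in> Obj C"
  shows "is_coproduct C A B (coprod C A B) (inj_left C A B) (inj_right C A B)"
proof -
  obtain S \<iota> where S: "S \<in> Obj C" "\<forall>i\<in>{0, 1 :: nat}. \<iota> i \<in> hom C (if i = 0 then A else B) S"
    "\<forall>X\<in>Obj C. \<forall>f. (\<forall>i\<in>{0, 1 :: nat}. f i \<in> hom C (if i = 0 then A else B) X) \<longrightarrow>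
      (\<exists>!h. h \<in> hom C S X \<and> (\<forall>i\<in>{0, 1}. h \<cdot> \<iota> i = f i))"
    using fc[unfolded has_finite_coproducts_def, rule_format, of "{0, 1}" "\<lambda>i. if i = 0 then A else B"]
      A B by auto
  have "is_coproduct C A B S (\<iota> 0) (\<iota> 1)"
    unfolding is_coproduct_def
  proof (intro conjI ballI)
    fix X f g assume X: "X \<in> Obj C" "f \<in> hom C A X" "g \<in> hom C B X"
    show "\<exists>!h. h \<in> hom C S X \<and> h \<cdot> \<iota> 0 = f \<and> h \<cdot> \<iota> 1 = g"
      using S(3)[rule_format, of X "\<lambda>i. if i = 0 then f else g"] X by auto
  qed (use S in auto)
  then have "\<exists>z. case z of (S, i, j) \<Rightarrow> is_coproduct C A B S i j" by auto
  then have "case coprod_cocone C A B of (S, i, j) \<Rightarrow> is_coproduct C A B S i j"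
    unfolding coprod_cocone_def by (rule someI_ex)
  then show ?thesis
    by (simp add: coprod_def inj_left_def inj_right_def split: prod.splits)
qed

end

locale exact_category_P = category C for C :: "('o, 'm) cat" (structure) +
  assumes exact: "exact_category C" and P: "condition_P C"
begin

lemma finite_limits_coproducts: "finitely_complete C" "has_finite_coproducts C"
  using P by (auto simp: condition_P_def)

lemmas ex_pb = ex_pullback[OF finite_limits_coproducts(1)]

section \<open>The calculus of copairs\<close>

lemma injections [simp]:
  assumes "A \<in> Obj C" "B \<in> Obj C"
  shows "coprod C A B \<in> Obj C"
    "inj_left C A B \<in> Arr C" "Dom C (inj_left C A B) = A" "Cod C (inj_left C A B) = coprod C A B"
    "inj_right C A B \<in> Arr C" "Dom C (inj_right C A B) = B" "Cod C (inj_right C A B) = coprod C A B"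
  using ex_coprod[OF finite_limits_coproducts(2) assms] by (auto simp: is_coproduct_def)

lemma copair_props:
  assumes "f \<in> Arr C" "g \<in> Arr C" "Cod C f = Cod C g"
  shows "copair C f g \<in> hom C (coprod C (Dom C f) (Dom C g)) (Cod C f) \<and>
    copair C f g \<cdot> inj_left C (Dom C f) (Dom C g) = f \<and> copair C f g \<cdot> inj_right C (Dom C f) (Dom C g) = g"
  unfolding copair_def
proof (rule theI')
  have "is_coproduct C (Dom C f) (Dom C g) (coprod C (Dom C f) (Dom C g))
      (inj_left C (Dom C f) (Dom C g)) (inj_right C (Dom C f) (Dom C g))"
    using assms by (intro ex_coprod finite_limits_coproducts) auto
  then show "\<exists>!h. h \<in> hom C (coprod C (Dom C f) (Dom C g)) (Cod C f) \<and>
      h \<cdot> inj_left C (Dom C f) (Dom C g) = f \<and> h \<cdot> inj_right C (Dom C f) (Dom C g) = g"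
    unfolding is_coproduct_def using assms by simp
qed

lemma copair_arr [simp]:
  assumes "f \<in> Arr C" "g \<in> Arr C" "Cod C f = Cod C g"
  shows "copair C f g \<in> Arr C" "Dom C (copair C f g) = coprod C (Dom C f) (Dom C g)"
    "Cod C (copair C f g) = Cod C g"
  using copair_props[OF assms] assms by auto

lemma copair_inj [simp]:
  assumes "f \<in> Arr C" "g \<in> Arr C" "Cod C f = Cod C g" "Dom C f = a" "Dom C g = b"
  shows "copair C f g \<cdot> inj_left C a b = f" "copair C f g \<cdot> inj_right C a b = g"
  using copair_props[OF assms(1-3)] assms by auto

lemma copair_inj_comp [simp]:
  assumes "f \<in> Arr C" "g \<in> Arr C" "Cod C f = Cod C g" "Dom C f = a" "Dom C g = b" "x \<in> Arr C"
  shows "Cod C x = a \<Longrightarrow> copair C f g \<cdot> (inj_left C a b \<cdot> x) = f \<cdot> x"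
    "Cod C x = b \<Longrightarrow> copair C f g \<cdot> (inj_right C a b \<cdot> x) = g \<cdot> x"
proof -
  have ab: "a \<in> Obj C" "b \<in> Obj C" using assms by auto
  show "copair C f g \<cdot> (inj_left C a b \<cdot> x) = f \<cdot> x" if "Cod C x = a"
    by (rule reassoc[OF copair_inj(1)]) (use assms that ab in auto)
  show "copair C f g \<cdot> (inj_right C a b \<cdot> x) = g \<cdot> x" if "Cod C x = b"
    by (rule reassoc[OF copair_inj(2)]) (use assms that ab in auto)
qed

lemma coprod_eqI:
  assumes "u \<in> Arr C" "v \<in> Arr C" "Cod C u = Cod C v" "Dom C u = coprod C A B" "Dom C v = coprod C A B"
    "A \<in> Obj C" "B \<in> Obj C" "u \<cdot> inj_left C A B = v \<cdot> inj_left C A B"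
    "u \<cdot> inj_right C A B = v \<cdot> inj_right C A B"
  shows "u = v"
proof -
  have "\<exists>!h. h \<in> hom C (coprod C A B) (Cod C u) \<and> h \<cdot> inj_left C A B = u \<cdot> inj_left C A B \<and>
      h \<cdot> inj_right C A B = u \<cdot> inj_right C A B"
    using ex_coprod[OF finite_limits_coproducts(2) assms(6,7)] assms unfolding is_coproduct_def by auto
  moreover have "u \<in> hom C (coprod C A B) (Cod C u)" "v \<in> hom C (coprod C A B) (Cod C u)"
    using assms by auto
  ultimately show ?thesis using assms(8,9) by metis
qed

lemma comp_copair [simp]:
  assumes "f \<in> Arr C" "g \<in> Arr C" "h \<in> Arr C" "Cod C f = Cod C g" "Cod C g = Dom C h"
  shows "h \<cdot> copair C f g = copair C (h \<cdot> f) (h \<cdot> g)"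
  by (rule coprod_eqI[of _ _ "Dom C f" "Dom C g"]) (use assms in auto)

lemma comp_copair_comp [simp]:
  assumes "f \<in> Arr C" "g \<in> Arr C" "h \<in> Arr C" "Cod C f = Cod C g" "Cod C g = Dom C h"
    "x \<in> Arr C" "Cod C x = coprod C (Dom C f) (Dom C g)"
  shows "h \<cdot> (copair C f g \<cdot> x) = copair C (h \<cdot> f) (h \<cdot> g) \<cdot> x"
  by (rule reassoc[OF comp_copair]) (use assms in auto)

lemma copair_injections [simp]:
  assumes "A \<in> Obj C" "B \<in> Obj C"
  shows "copair C (inj_left C A B) (inj_right C A B) = Ident C (coprod C A B)"
  by (rule coprod_eqI[of _ _ A B]) (use assms in auto)

lemma coprod_arr_eq [simp]:
  "coprod_arr C f g = copair C (inj_left C (Cod C f) (Cod C g) \<cdot> f) (inj_right C (Cod C f) (Cod C g) \<cdot> g)"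
  by (simp add: coprod_arr_def)

section \<open>Regular epimorphisms as covers\<close>

lemma regular: "regular_category C"
  using exact by (simp add: exact_category_def)

text \<open>Pullback stability of regular epimorphisms in the form used throughout: a generalized
  element \<open>x\<close> of the codomain lifts along \<open>e\<close> after restriction to a cover
  \<open>c\<close>.\<close>

lemma cover_pullback:
  assumes e: "regular_epi C e" and x: "x \<in> Arr C" "Cod C x = Cod C e"
  obtains c y where "regular_epi C c" "c \<in> Arr C" "Cod C c = Dom C x" "y \<in> Arr C" "Dom C y = Dom C c"
    "Cod C y = Dom C e" "x \<cdot> c = e \<cdot> y"
proof -
  obtain y c where pb: "is_pullback C y c e x"
    using ex_pb[of e x] e x regular_epi_arr by auto
  then have "regular_epi C c" using regular e unfolding regular_category_def by blast
  with pullbackD[OF pb] show thesis by (intro that[of c y]) auto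
qed

lemma cover_eq:
  assumes "regular_epi C c" "u \<cdot> c = v \<cdot> c" "u \<in> Arr C" "v \<in> Arr C" "Cod C u = Cod C v"
    "Dom C u = Cod C c" "Dom C v = Cod C c"
  shows "u = v"
  using epiD[OF regular_epi_epi] assms by blast

lemma ex_kernel_pair:
  assumes "f \<in> Arr C"
  obtains k1 k2 e where "is_pullback C k1 k2 f f" "is_coequalizer C k1 k2 e"
proof -
  obtain k1 k2 where k: "is_pullback C k1 k2 f f" using ex_pb[of f f] assms by auto
  moreover obtain e where "is_coequalizer C k1 k2 e"
    using k regular unfolding regular_category_def is_kernel_pair_def by blast
  ultimately show thesis using that by blast
qed

text \<open>A regular epimorphism is the coequalizer of its own kernel pair, because any pair that
  it coequalizes factors through that kernel pair.\<close>

lemma regular_epi_factor: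
  assumes p: "regular_epi C p" and n: "is_pullback C n1 n2 p p" and h: "h \<in> Arr C" "Dom C h = Dom C p"
    "h \<cdot> n1 = h \<cdot> n2"
  obtains k where "k \<in> Arr C" "Dom C k = Cod C p" "Cod C k = Cod C h" "k \<cdot> p = h"
proof -
  obtain a b where ab: "is_coequalizer C a b p" using p unfolding regular_epi_def by blast
  then have ab': "a \<in> Arr C" "b \<in> Arr C" "Dom C a = Dom C b" "Cod C a = Dom C p" "Cod C b = Dom C p"
    "p \<cdot> a = p \<cdot> b" by (auto simp: is_coequalizer_def)
  obtain w where w: "w \<in> Arr C" "Cod C w = Dom C n2" "n1 \<cdot> w = a" "n2 \<cdot> w = b"
    using pullbackE[OF n, of a b] ab' by auto
  have "h \<cdot> a = h \<cdot> b"
    using reassoc[OF h(3), of w] w h pullbackD[OF n] by auto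
  then show thesis using coequalizerE[OF ab h(1,2)] that by blast
qed

text \<open>Here \<open>e\<close> is the coequalizer of the kernel pair of \<open>f\<close>. The
  induced \<open>m\<close> is mono because two elements that it identifies lift, over a common
  cover, to a point of that kernel pair, on which \<open>e\<close> agrees.\<close>

lemma image_factorization:
  assumes f: "f \<in> Arr C"
  obtains e m where "regular_epi C e" "mono_arr C m" "m \<in> Arr C" "e \<in> Arr C" "Dom C m = Cod C e"
    "Dom C e = Dom C f" "Cod C m = Cod C f" "m \<cdot> e = f"
proof -
  obtain k1 k2 e where k: "is_pullback C k1 k2 f f" and e: "is_coequalizer C k1 k2 e"
    using ex_kernel_pair[OF f] .
  note kD = pullbackD[OF k]
  have e': "e \<in> Arr C" "Dom C e = Dom C f" "e \<cdot> k1 = e \<cdot> k2" using e kD by (auto simp: is_coequalizer_def)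
  have re: "regular_epi C e" using e unfolding regular_epi_def by blast
  obtain m where m: "m \<in> Arr C" "Dom C m = Cod C e" "Cod C m = Cod C f" "m \<cdot> e = f"
    using coequalizerE[OF e, of f] f e' kD by metis
  have "mono_arr C m"
    unfolding mono_arr_def
  proof (intro conjI allI impI)
    fix u v assume uv: "u \<in> Arr C \<and> v \<in> Arr C \<and> Dom C u = Dom C v \<and> Cod C u = Dom C m \<and>
      Cod C v = Dom C m \<and> m \<cdot> u = m \<cdot> v"
    obtain c x where c: "regular_epi C c" "c \<in> Arr C" "Cod C c = Dom C u" "x \<in> Arr C" "Dom C x = Dom C c"
      "Cod C x = Dom C e" "u \<cdot> c = e \<cdot> x"
      using cover_pullback[OF re, of u] uv m by auto
    obtain d y where d: "regular_epi C d" "d \<in> Arr C" "Cod C d = Dom C c" "y \<in> Arr C" "Dom C y = Dom C d"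
      "Cod C y = Dom C e" "(v \<cdot> c) \<cdot> d = e \<cdot> y"
      using cover_pullback[OF re, of "v \<cdot> c"] uv m c by auto
    have "f \<cdot> (x \<cdot> d) = m \<cdot> (u \<cdot> (c \<cdot> d))"
      using reassoc[OF m(4), of "x \<cdot> d"] reassoc[OF c(7), of d] uv m c d e' by simp
    also have "\<dots> = m \<cdot> (v \<cdot> (c \<cdot> d))"
      using uv c d reassoc[of m u "m \<cdot> v" "c \<cdot> d"] m by simp
    also have "\<dots> = f \<cdot> y"
      using reassoc[OF m(4), of y] uv m c d e' by simp
    finally obtain w where w: "w \<in> Arr C" "Cod C w = Dom C k2" "k1 \<cdot> w = x \<cdot> d" "k2 \<cdot> w = y"
      "Dom C w = Dom C d"
      using pullbackE[OF k, of "x \<cdot> d" y] uv m c d e' by auto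
    have "(u \<cdot> c) \<cdot> d = (v \<cdot> c) \<cdot> d"
      using reassoc[OF e'(3), of w] w kD d c e' uv reassoc[OF c(7), of d] by simp
    then have "u \<cdot> c = v \<cdot> c"
      by (rule cover_eq[OF d(1)]) (use uv c d e' m in simp_all)
    then show "u = v"
      by (rule cover_eq[OF c(1)]) (use uv c in simp_all)
  qed (rule m)
  with re m e' show thesis by (intro that[of e m]) auto
qed

text \<open>The relation generated by \<open>t1\<close> and \<open>t2\<close>: the pairing into the
  product of \<open>A\<close> with itself is factored, and the mono part is composed with the
  projections.\<close>

lemma joint_image:
  assumes t: "t1 \<in> Arr C" "t2 \<in> Arr C" "Dom C t1 = Dom C t2" "Cod C t1 = A" "Cod C t2 = A"
  obtains e r1 r2 where "regular_epi C e" "e \<in> Arr C" "Dom C e = Dom C t1" "jointly_monic C r1 r2"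
    "r1 \<in> hom C (Cod C e) A" "r2 \<in> hom C (Cod C e) A" "r1 \<cdot> e = t1" "r2 \<cdot> e = t2"
proof -
  have A: "A \<in> Obj C" using t by auto
  obtain p q where pq: "p \<in> Arr C" "q \<in> Arr C" "Dom C p = Dom C q" "Cod C p = A" "Cod C q = A"
    and ex: "\<And>u v. u \<in> Arr C \<Longrightarrow> v \<in> Arr C \<Longrightarrow> Dom C u = Dom C v \<Longrightarrow> Cod C u = A \<Longrightarrow> Cod C v = A \<Longrightarrow>
      \<exists>w. w \<in> hom C (Dom C u) (Dom C p) \<and> p \<cdot> w = u \<and> q \<cdot> w = v"
    and uniq: "\<And>w w'. w \<in> Arr C \<Longrightarrow> w' \<in> Arr C \<Longrightarrow> Dom C w = Dom C w' \<Longrightarrow> Cod C w = Dom C p \<Longrightarrow>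
      Cod C w' = Dom C p \<Longrightarrow> p \<cdot> w = p \<cdot> w' \<Longrightarrow> q \<cdot> w = q \<cdot> w' \<Longrightarrow> w = w'"
    by (rule ex_product[OF finite_limits_coproducts(1) A A]) (rule that)
  obtain t where tt: "t \<in> Arr C" "Dom C t = Dom C t1" "Cod C t = Dom C p" "p \<cdot> t = t1" "q \<cdot> t = t2"
    using ex[of t1 t2] t by auto
  obtain e m where e: "regular_epi C e" and m: "mono_arr C m" and em: "m \<in> Arr C" "e \<in> Arr C"
    "Dom C m = Cod C e" "Dom C e = Dom C t" "Cod C m = Cod C t" "m \<cdot> e = t"
    using image_factorization[OF tt(1)] .
  have "jointly_monic C (p \<cdot> m) (q \<cdot> m)"
    unfolding jointly_monic_def
  proof (intro conjI allI impI)
    fix u v assume uv: "u \<in> Arr C \<and> v \<in> Arr C \<and> Dom C u = Dom C v \<and> Cod C u = Dom C (p \<cdot> m) \<and>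
      Cod C v = Dom C (p \<cdot> m) \<and> (p \<cdot> m) \<cdot> u = (p \<cdot> m) \<cdot> v \<and> (q \<cdot> m) \<cdot> u = (q \<cdot> m) \<cdot> v"
    then have uv': "u \<in> Arr C" "v \<in> Arr C" "Dom C u = Dom C v" "Cod C u = Dom C m" "Cod C v = Dom C m"
      using em tt pq by simp_all
    have eq: "p \<cdot> (m \<cdot> u) = p \<cdot> (m \<cdot> v)" "q \<cdot> (m \<cdot> u) = q \<cdot> (m \<cdot> v)"
      using uv uv' em tt pq by simp_all
    have "m \<cdot> u = m \<cdot> v"
      by (rule uniq) (use eq uv' em tt pq in simp_all)
    then show "u = v" using monoD[OF m] uv' by blast
  qed (use em tt pq in auto)
  then show thesis
    using e em tt pq by (intro that[of e "p \<cdot> m" "q \<cdot> m"]) auto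
qed

section \<open>Pullbacks of copairs\<close>

text \<open>Degenerate squares, which serve as summands in condition (b).\<close>

lemma pullback_trivial:
  assumes "g \<in> Arr C" "Dom C g = A" "Cod C g = B"
  shows "is_pullback C (Ident C A) g g (Ident C B)" "is_pullback C g (Ident C A) (Ident C B) g"
proof -
  have A: "A \<in> Obj C" "B \<in> Obj C" using assms by auto
  show "is_pullback C (Ident C A) g g (Ident C B)"
    by (rule pullbackI) (use assms A in auto)
  show "is_pullback C g (Ident C A) (Ident C B) g"
    by (rule pullbackI) (use assms A in auto)
qed

lemma pullback_coprod_arr:
  assumes "is_pullback C t l r b" "is_pullback C t' l' r' b'"
  shows "is_pullback C (coprod_arr C t t') (coprod_arr C l l') (coprod_arr C r r') (coprod_arr C b b')"
  using P assms unfolding condition_P_def by blast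

lemma pullback_copair_mono:
  assumes "mono_arr C m" "m \<in> Arr C" "Dom C m = S" "Cod C m = A"
  shows "is_pullback C (coprod_arr C m (Ident C S)) (copair C (Ident C S) (Ident C S))
          (copair C (Ident C A) m) m"
proof -
  have "m \<in> hom C S A" using assms by simp
  then show ?thesis using P assms(1) unfolding condition_P_def by blast
qed

text \<open>Since \<open>[f, u g] = [1, u] (f + g)\<close>, its pullback along \<open>u\<close> is a
  pasting: square (c) for \<open>u\<close>, preceded by the coproduct, by (b), of the given pullback
  with a trivial square. It is therefore computed summand by summand.\<close>

lemma pullback_copair_along_mono:
  assumes u: "mono_arr C u" and pb: "is_pullback C s f' f u"
    and g: "g \<in> Arr C" "Cod C g = Dom C u"
    and y: "y \<in> Arr C" "Cod C y = coprod C (Dom C f) (Dom C g)"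
    and x: "x \<in> Arr C" "Cod C x = Dom C u" "Dom C x = Dom C y"
    and eq: "copair C f (u \<cdot> g) \<cdot> y = u \<cdot> x"
  obtains z where "z \<in> Arr C" "Dom C z = Dom C x" "Cod C z = coprod C (Dom C s) (Dom C g)"
    "coprod_arr C s (Ident C (Dom C g)) \<cdot> z = y" "copair C f' g \<cdot> z = x"
proof -
  note pbD = pullbackD[OF pb]
  let ?U = "Dom C u"
  have pbc: "is_pullback C (coprod_arr C u (Ident C ?U)) (copair C (Ident C ?U) (Ident C ?U))
          (copair C (Ident C (Cod C u)) u) u"
    using pullback_copair_mono[OF u _ refl refl] pbD by simp
  obtain w where w: "w \<in> Arr C" "Dom C w = Dom C x" "Cod C w = coprod C ?U ?U"
     "coprod_arr C u (Ident C ?U) \<cdot> w = coprod_arr C f g \<cdot> y" "copair C (Ident C ?U) (Ident C ?U) \<cdot> w = x"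
    using pullbackE[OF pbc, of "coprod_arr C f g \<cdot> y" x] pbD g y x eq by auto
  have pbs: "is_pullback C (coprod_arr C s (Ident C (Dom C g))) (coprod_arr C f' g) (coprod_arr C f g)
      (coprod_arr C u (Ident C ?U))"
    using pullback_coprod_arr[OF pb pullback_trivial(1)[OF g(1) refl g(2)]] pbD by simp
  obtain z where z: "z \<in> Arr C" "Dom C z = Dom C x" "Cod C z = coprod C (Dom C s) (Dom C g)"
     "coprod_arr C s (Ident C (Dom C g)) \<cdot> z = y" "coprod_arr C f' g \<cdot> z = w"
    using pullbackE[OF pbs, of y w] pbD g y x w by auto
  have "copair C f' g \<cdot> z = copair C (Ident C ?U) (Ident C ?U) \<cdot> (coprod_arr C f' g \<cdot> z)"
    using z(1-3) pbD g by simp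
  then have "copair C f' g \<cdot> z = x" using z w by simp
  with z show thesis by (intro that[of z]) auto
qed

text \<open>The counterpart for a regular epimorphism: \<open>[f, f'] = [1, 1] (f + f')\<close>,
  with (d) in place of (c). As (d) gives only a feeble pullback, the resulting point
  \<open>d\<close> exists over a cover of the given one.\<close>

lemma cover_copair:
  assumes p: "regular_epi C p" and pb: "is_pullback C s l f p" and pb': "is_pullback C s' l' f' p"
    and x: "x \<in> Arr C" "Cod C x = coprod C (Dom C f) (Dom C f')"
    and e: "e \<in> Arr C" "Cod C e = Dom C p" "Dom C e = Dom C x"
    and eq: "copair C f f' \<cdot> x = p \<cdot> e"
  obtains c d where "regular_epi C c" "c \<in> Arr C" "Cod C c = Dom C x" "d \<in> Arr C" "Dom C d = Dom C c"
    "Cod C d = coprod C (Dom C s) (Dom C s')" "coprod_arr C s s' \<cdot> d = x \<cdot> c" "copair C l l' \<cdot> d = e \<cdot> c"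
proof -
  note pbD = pullbackD[OF pb] note pbD' = pullbackD[OF pb']
  let ?E = "Dom C p" and ?B = "Cod C p"
  have "feeble_pullback C (coprod_arr C p p) (copair C (Ident C ?E) (Ident C ?E))
          (copair C (Ident C ?B) (Ident C ?B)) p"
    using P p pbD unfolding condition_P_def hom_iff by blast
  then obtain h k w where hk: "is_pullback C h k (copair C (Ident C ?B) (Ident C ?B)) p"
    and w: "w \<in> Arr C" "Dom C w = coprod C ?E ?E" "Cod C w = Dom C h" "h \<cdot> w = coprod_arr C p p"
      "k \<cdot> w = copair C (Ident C ?E) (Ident C ?E)" "regular_epi C w"
    unfolding feeble_pullback_def using pbD by auto
  note hkD = pullbackD[OF hk]
  have hkD': "Cod C h = coprod C ?B ?B" using hkD pbD by simp
  have "copair C (Ident C ?B) (Ident C ?B) \<cdot> (coprod_arr C f f' \<cdot> x) = p \<cdot> e"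
    using eq pbD pbD' x by simp
  then obtain v where v: "v \<in> Arr C" "Dom C v = Dom C x" "Cod C v = Dom C k"
      "h \<cdot> v = coprod_arr C f f' \<cdot> x" "k \<cdot> v = e"
    using pullbackE[OF hk, of "coprod_arr C f f' \<cdot> x" e] pbD pbD' x e by auto
  \<comment> \<open>\<open>v\<close> is a point of the true pullback and \<open>w\<close> is the
    regular epimorphism comparing \<open>E + E\<close> with it, so \<open>v\<close> lifts along
    \<open>w\<close> over a cover.\<close>
  obtain c d where c: "regular_epi C c" "c \<in> Arr C" "Cod C c = Dom C v" "d \<in> Arr C" "Dom C d = Dom C c"
    "Cod C d = Dom C w" "v \<cdot> c = w \<cdot> d"
    using cover_pullback[OF w(6), of v] v w hkD by auto
  have pbs: "is_pullback C (coprod_arr C s s') (coprod_arr C l l') (coprod_arr C f f') (coprod_arr C p p)"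
    using pullback_coprod_arr[OF pb pb'] .
  have 1: "coprod_arr C p p \<cdot> d = coprod_arr C f f' \<cdot> (x \<cdot> c)"
    using reassoc[OF w(4), of d] reassoc[OF v(4), of c] c v w hkD x pbD pbD' by simp
  have 2: "copair C (Ident C ?E) (Ident C ?E) \<cdot> d = e \<cdot> c"
    using reassoc[OF w(5), of d] reassoc[OF v(5), of c] c v w hkD x pbD by simp
  obtain z where z: "z \<in> Arr C" "Dom C z = Dom C c" "Cod C z = coprod C (Dom C s) (Dom C s')"
    "coprod_arr C s s' \<cdot> z = x \<cdot> c" "coprod_arr C l l' \<cdot> z = d"
    using pullbackE[OF pbs, of "x \<cdot> c" d] 1 c w v x pbD pbD' by auto
  have "copair C l l' \<cdot> z = copair C (Ident C ?E) (Ident C ?E) \<cdot> (coprod_arr C l l' \<cdot> z)"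
    using z(1-3) pbD pbD' by simp
  then have "copair C l l' \<cdot> z = e \<cdot> c" using z 2 by simp
  with z c v show thesis by (intro that[of c z]) auto
qed

section \<open>Gluing along a monomorphism\<close>

text \<open>If \<open>[1, u g]\<close> sends \<open>d\<close> into the subobject \<open>u\<close>,
  then \<open>d\<close> comes from \<open>U + N\<close>, where \<open>U\<close> and \<open>N\<close>
  are the domains of \<open>u\<close> and \<open>g\<close>. Hence \<open>[1, u g']\<close> sends it
  into \<open>u\<close> as well.\<close>

lemma saturation:
  assumes u: "mono_arr C u" "u \<in> Arr C" and g: "g \<in> Arr C" "g' \<in> Arr C" "Cod C g = Dom C u"
    "Cod C g' = Dom C u" "Dom C g = Dom C g'"
    and d: "d \<in> Arr C" "Cod C d = coprod C (Cod C u) (Dom C g)"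
    and x: "x \<in> Arr C" "Cod C x = Dom C u" "Dom C x = Dom C d"
    and eq: "copair C (Ident C (Cod C u)) (u \<cdot> g) \<cdot> d = u \<cdot> x"
  obtains z where "z \<in> Arr C" "Dom C z = Dom C d" "Cod C z = coprod C (Dom C u) (Dom C g)"
    "copair C (Ident C (Dom C u)) g \<cdot> z = x"
    "copair C (Ident C (Cod C u)) (u \<cdot> g') \<cdot> d = u \<cdot> (copair C (Ident C (Dom C u)) g' \<cdot> z)"
proof -
  obtain z where z: "z \<in> Arr C" "Dom C z = Dom C x" "Cod C z = coprod C (Dom C u) (Dom C g)"
    "coprod_arr C u (Ident C (Dom C g)) \<cdot> z = d" "copair C (Ident C (Dom C u)) g \<cdot> z = x"
    using pullback_copair_along_mono[OF u(1) pullback_trivial(2)[OF u(2) refl refl] g(1,3), of d x] u g d x eq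
    by auto
  have "copair C (Ident C (Cod C u)) (u \<cdot> g') \<cdot> (coprod_arr C u (Ident C (Dom C g)) \<cdot> z) =
      u \<cdot> (copair C (Ident C (Dom C u)) g' \<cdot> z)"
    using z(1-3) u g by simp
  with z x show thesis by (intro that[of z]) simp_all
qed

section \<open>Internal relations tested on generalized elements\<close>

definition related :: "'m \<Rightarrow> 'm \<Rightarrow> 'm \<Rightarrow> 'm \<Rightarrow> bool" where
  "related r1 r2 x y \<longleftrightarrow> (\<exists>w \<in> Arr C. Cod C w = Dom C r1 \<and> r1 \<cdot> w = x \<and> r2 \<cdot> w = y)"

lemma related_comp:
  assumes "related r1 r2 x y" "r1 \<in> Arr C" "r2 \<in> Arr C" "Dom C r1 = Dom C r2" "z \<in> Arr C" "Cod C z = Dom C x"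
  shows "related r1 r2 (x \<cdot> z) (y \<cdot> z)"
proof -
  obtain w where w: "w \<in> Arr C" "Cod C w = Dom C r1" "r1 \<cdot> w = x" "r2 \<cdot> w = y"
    using assms(1) unfolding related_def by blast
  then have "Dom C w = Dom C x" using assms by auto
  with w assms show ?thesis unfolding related_def
    by (intro bexI[of _ "w \<cdot> z"]) (auto simp: reassoc[OF w(3)] reassoc[OF w(4)])
qed

lemma related_copair:
  assumes "related r1 r2 x y" "related r1 r2 x' y'" "r1 \<in> Arr C" "r2 \<in> Arr C" "Dom C r1 = Dom C r2"
  shows "related r1 r2 (copair C x x') (copair C y y')"
proof -
  obtain w w' where "w \<in> Arr C" "Cod C w = Dom C r1" "r1 \<cdot> w = x" "r2 \<cdot> w = y"
    "w' \<in> Arr C" "Cod C w' = Dom C r1" "r1 \<cdot> w' = x'" "r2 \<cdot> w' = y'"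
    using assms(1,2) unfolding related_def by blast
  with assms(3-) show ?thesis unfolding related_def
    by (intro bexI[of _ "copair C w w'"]) auto
qed

text \<open>Membership in a relation is local: joint monicity makes the witness over the cover
  \<open>c\<close> coequalize the pair defining \<open>c\<close>, so the witness descends along
  \<open>c\<close>.\<close>

lemma related_descend:
  assumes jm: "jointly_monic C r1 r2" and c: "regular_epi C c" and rel: "related r1 r2 (x \<cdot> c) (y \<cdot> c)"
    and xy: "x \<in> Arr C" "y \<in> Arr C" "Dom C x = Cod C c" "Dom C y = Cod C c" "Cod C x = Cod C r1"
      "Cod C y = Cod C r2"
  shows "related r1 r2 x y"
proof -
  have r: "r1 \<in> Arr C" "r2 \<in> Arr C" "Dom C r1 = Dom C r2" using jm unfolding jointly_monic_def by blast+
  obtain w where w: "w \<in> Arr C" "Cod C w = Dom C r1" "r1 \<cdot> w = x \<cdot> c" "r2 \<cdot> w = y \<cdot> c"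
    using rel unfolding related_def by blast
  obtain a b where ab: "is_coequalizer C a b c" using c unfolding regular_epi_def by blast
  then have ab': "a \<in> Arr C" "b \<in> Arr C" "c \<in> Arr C" "Dom C a = Dom C b" "Cod C a = Dom C c" "Cod C b = Dom C c"
    "c \<cdot> a = c \<cdot> b" by (auto simp: is_coequalizer_def)
  have "Dom C (r1 \<cdot> w) = Dom C (x \<cdot> c)" by (simp add: w(3))
  then have dw: "Dom C w = Dom C c" using xy w(1,2) r ab' by simp
  have "r1 \<cdot> (w \<cdot> a) = x \<cdot> (c \<cdot> a)" "r1 \<cdot> (w \<cdot> b) = x \<cdot> (c \<cdot> b)"
    "r2 \<cdot> (w \<cdot> a) = y \<cdot> (c \<cdot> a)" "r2 \<cdot> (w \<cdot> b) = y \<cdot> (c \<cdot> b)"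
    using reassoc[OF w(3), of a] reassoc[OF w(3), of b] reassoc[OF w(4), of a] reassoc[OF w(4), of b]
      w(1,2) r ab'(1-6) xy dw by simp_all
  then have "r1 \<cdot> (w \<cdot> a) = r1 \<cdot> (w \<cdot> b)" "r2 \<cdot> (w \<cdot> a) = r2 \<cdot> (w \<cdot> b)" by (simp_all add: ab'(7))
  moreover have "w \<cdot> a \<in> Arr C" "w \<cdot> b \<in> Arr C" "Dom C (w \<cdot> a) = Dom C (w \<cdot> b)" "Cod C (w \<cdot> a) = Dom C r1"
    "Cod C (w \<cdot> b) = Dom C r1" using w(1,2) ab' dw by simp_all
  ultimately have "w \<cdot> a = w \<cdot> b" using jm unfolding jointly_monic_def by blast
  then obtain k where k: "k \<in> Arr C" "Dom C k = Cod C c" "Cod C k = Cod C w" "k \<cdot> c = w"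
    using coequalizerE[OF ab, of w] w(1) dw by metis
  have "r1 \<cdot> k = x"
    by (rule cover_eq[OF c]) (use k w r xy ab' in auto)
  moreover have "r2 \<cdot> k = y"
    by (rule cover_eq[OF c]) (use k w r xy ab' in auto)
  ultimately show ?thesis unfolding related_def using k w by auto
qed

end

text \<open>The relation \<open>r1, r2\<close> on \<open>A\<close> is the image of the pair
  \<open>[1, m n1], [1, m n2]\<close>: besides the diagonal it contains the kernel pair of
  \<open>p\<close>, transported along \<open>m\<close>. It presents the gluing of \<open>A\<close>
  along \<open>p\<close>.\<close>

locale gluing = exact_category_P C for C :: "('o, 'm) cat" (structure) +
  fixes m p n1 n2 e r1 r2
  assumes m: "mono_arr C m" and p: "regular_epi C p" and dom_p: "Dom C p = Dom C m"
    and n: "is_pullback C n1 n2 p p"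
    and e: "regular_epi C e" "Dom C e = coprod C (Cod C m) (Dom C n1)"
    and r: "jointly_monic C r1 r2" "Dom C r1 = Cod C e" "Cod C r1 = Cod C m" "Cod C r2 = Cod C m"
      "r1 \<cdot> e = copair C (Ident C (Cod C m)) (m \<cdot> n1)" "r2 \<cdot> e = copair C (Ident C (Cod C m)) (m \<cdot> n2)"
begin

abbreviation "A \<equiv> Cod C m"
abbreviation "N \<equiv> Dom C n1"
definition "t1 = copair C (Ident C A) (m \<cdot> n1)"
definition "t2 = copair C (Ident C A) (m \<cdot> n2)"
abbreviation "rel \<equiv> related r1 r2"

lemma arrs [simp]:
  "m \<in> Arr C" "p \<in> Arr C" "n1 \<in> Arr C" "n2 \<in> Arr C" "Dom C n2 = N" "Cod C n1 = Dom C m" "Cod C n2 = Dom C m"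
  "e \<in> Arr C" "r1 \<in> Arr C" "r2 \<in> Arr C" "Dom C r1 = Cod C e" "Dom C r2 = Cod C e" "Cod C r1 = A" "Cod C r2 = A"
  "Dom C p = Dom C m" "Dom C e = coprod C A N"
proof -
  have a: "m \<in> Arr C" "p \<in> Arr C" "e \<in> Arr C" "r1 \<in> Arr C" "r2 \<in> Arr C" "Dom C r1 = Dom C r2"
    using m r(1) regular_epi_arr[OF p] regular_epi_arr[OF e(1)] unfolding mono_arr_def jointly_monic_def
    by blast+
  show "m \<in> Arr C" "p \<in> Arr C" "n1 \<in> Arr C" "n2 \<in> Arr C" "Dom C n2 = N" "Cod C n1 = Dom C m" "Cod C n2 = Dom C m"
    "e \<in> Arr C" "r1 \<in> Arr C" "r2 \<in> Arr C" "Dom C r1 = Cod C e" "Dom C r2 = Cod C e" "Cod C r1 = A" "Cod C r2 = A"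
    "Dom C p = Dom C m" "Dom C e = coprod C A N"
    using a pullbackD(1-7)[OF n] dom_p e(2) r(2-4) by simp_all
qed

lemma t_arr [simp]:
  "t1 \<in> Arr C" "Dom C t1 = coprod C A N" "Cod C t1 = A"
  "t2 \<in> Arr C" "Dom C t2 = coprod C A N" "Cod C t2 = A"
  by (auto simp: t1_def t2_def)

lemma t_inj [simp]:
  "t1 \<cdot> inj_left C A N = Ident C A" "t1 \<cdot> inj_right C A N = m \<cdot> n1"
  "t2 \<cdot> inj_left C A N = Ident C A" "t2 \<cdot> inj_right C A N = m \<cdot> n2"
  by (auto simp: t1_def t2_def)

lemma t_inj_comp [simp]:
  "x \<in> Arr C \<Longrightarrow> Cod C x = A \<Longrightarrow> t1 \<cdot> (inj_left C A N \<cdot> x) = x"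
  "x \<in> Arr C \<Longrightarrow> Cod C x = N \<Longrightarrow> t1 \<cdot> (inj_right C A N \<cdot> x) = m \<cdot> (n1 \<cdot> x)"
  "x \<in> Arr C \<Longrightarrow> Cod C x = A \<Longrightarrow> t2 \<cdot> (inj_left C A N \<cdot> x) = x"
  "x \<in> Arr C \<Longrightarrow> Cod C x = N \<Longrightarrow> t2 \<cdot> (inj_right C A N \<cdot> x) = m \<cdot> (n2 \<cdot> x)"
  by (auto simp: t1_def t2_def)

lemma rt: "r1 \<cdot> e = t1" "r2 \<cdot> e = t2"
  using r by (auto simp: t1_def t2_def)

lemma p_n: "p \<cdot> n1 = p \<cdot> n2"
  using pullbackD[OF n] by simp

lemma rel_t: "d \<in> Arr C \<Longrightarrow> Cod C d = coprod C A N \<Longrightarrow> rel (t1 \<cdot> d) (t2 \<cdot> d)"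
  unfolding related_def by (intro bexI[of _ "e \<cdot> d"]) (auto simp: reassoc[OF rt(1)] reassoc[OF rt(2)])

lemma rel_cover:
  assumes "rel x y"
  obtains c d where "regular_epi C c" "c \<in> Arr C" "Cod C c = Dom C x" "d \<in> Arr C" "Dom C d = Dom C c"
    "Cod C d = coprod C A N" "t1 \<cdot> d = x \<cdot> c" "t2 \<cdot> d = y \<cdot> c"
proof -
  obtain w where w: "w \<in> Arr C" "Cod C w = Dom C r1" "r1 \<cdot> w = x" "r2 \<cdot> w = y"
    using assms unfolding related_def by blast
  then have dw: "Dom C x = Dom C w" by auto
  obtain c d where c: "regular_epi C c" "c \<in> Arr C" "Cod C c = Dom C w" "d \<in> Arr C" "Dom C d = Dom C c"
    "Cod C d = Dom C e" "w \<cdot> c = e \<cdot> d"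
    using cover_pullback[OF e(1) w(1)] w(2) by auto
  have "t1 \<cdot> d = x \<cdot> c" "t2 \<cdot> d = y \<cdot> c"
    using reassoc[OF rt(1), of d] reassoc[OF rt(2), of d] reassoc[OF w(3), of c] reassoc[OF w(4), of c]
      c w(1,2) by auto
  with c dw show thesis by (intro that[of c d]) auto
qed

lemma rel_arr:
  assumes "rel x y"
  shows "x \<in> Arr C" "y \<in> Arr C" "Dom C y = Dom C x" "Cod C x = A" "Cod C y = A"
  using assms unfolding related_def by auto

lemma rel_sym:
  assumes xy: "rel x y"
  shows "rel y x"
proof -
  note a = rel_arr[OF xy]
  \<comment> \<open>The swap of the kernel pair of \<open>p\<close>. Applied on the summand
    \<open>N\<close>, it exchanges \<open>t1\<close> and \<open>t2\<close>.\<close>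
  obtain \<sigma> where s: "\<sigma> \<in> Arr C" "Dom C \<sigma> = N" "Cod C \<sigma> = N" "n1 \<cdot> \<sigma> = n2" "n2 \<cdot> \<sigma> = n1"
    using pullbackE[OF n, of n2 n1] p_n by auto
  let ?s = "copair C (inj_left C A N) (inj_right C A N \<cdot> \<sigma>)"
  have ts: "t1 \<cdot> ?s = t2" "t2 \<cdot> ?s = t1"
    using s by (simp_all add: t1_def t2_def)
  obtain c d where c: "regular_epi C c" "c \<in> Arr C" "Cod C c = Dom C x" "d \<in> Arr C" "Dom C d = Dom C c"
    "Cod C d = coprod C A N" "t1 \<cdot> d = x \<cdot> c" "t2 \<cdot> d = y \<cdot> c"
    using rel_cover[OF xy] .
  have "rel (t1 \<cdot> (?s \<cdot> d)) (t2 \<cdot> (?s \<cdot> d))"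
    by (rule rel_t) (use s c in auto)
  moreover have "t1 \<cdot> (?s \<cdot> d) = y \<cdot> c" "t2 \<cdot> (?s \<cdot> d) = x \<cdot> c"
    using reassoc[OF ts(1), of d] reassoc[OF ts(2), of d] s c by auto
  ultimately have "rel (y \<cdot> c) (x \<cdot> c)" by simp
  then show ?thesis
    by (rule related_descend[OF r(1) c(1)]) (use a c in auto)
qed

text \<open>Every subobject \<open>u\<close> through which \<open>m\<close> factors is closed under
  the relation: with \<open>m = u k\<close> the maps \<open>t1, t2\<close> have the form required by
  \<open>saturation\<close>.\<close>

lemma rel_saturated:
  assumes u: "mono_arr C u" "u \<in> Arr C" "Cod C u = A"
    and k: "k \<in> Arr C" "Dom C k = Dom C m" "Cod C k = Dom C u" "u \<cdot> k = m"
    and d: "d \<in> Arr C" "Cod C d = coprod C A N"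
    and x: "x \<in> Arr C" "Cod C x = Dom C u" "Dom C x = Dom C d" "t1 \<cdot> d = u \<cdot> x"
  obtains z where "z \<in> Arr C" "Dom C z = Dom C d" "Cod C z = coprod C (Dom C u) N"
    "copair C (Ident C (Dom C u)) (k \<cdot> n1) \<cdot> z = x" "t2 \<cdot> d = u \<cdot> (copair C (Ident C (Dom C u)) (k \<cdot> n2) \<cdot> z)"
proof -
  have t: "t1 = copair C (Ident C (Cod C u)) (u \<cdot> (k \<cdot> n1))" "t2 = copair C (Ident C (Cod C u)) (u \<cdot> (k \<cdot> n2))"
    unfolding t1_def t2_def u(3) using reassoc[OF k(4), of n1] reassoc[OF k(4), of n2] u k by auto
  show thesis
    by (rule saturation[OF u(1,2), of "k \<cdot> n1" "k \<cdot> n2" d x]) (use that k d x u in \<open>simp_all add: t\<close>)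
qed

text \<open>The case \<open>u = m\<close>, with more information: on elements of \<open>m\<close>
  the relation adds nothing beyond the kernel pair of \<open>p\<close>. This is what later makes the
  image of \<open>p\<close> embed in the quotient.\<close>

lemma rel_saturated_m:
  assumes d: "d \<in> Arr C" "Cod C d = coprod C A N"
    and x: "x \<in> Arr C" "Cod C x = Dom C m" "Dom C x = Dom C d" "t1 \<cdot> d = m \<cdot> x"
  obtains y where "y \<in> Arr C" "Dom C y = Dom C d" "Cod C y = Dom C m" "t2 \<cdot> d = m \<cdot> y" "p \<cdot> x = p \<cdot> y"
proof -
  obtain z where z: "z \<in> Arr C" "Dom C z = Dom C d" "Cod C z = coprod C (Dom C m) N"
    "copair C (Ident C (Dom C m)) n1 \<cdot> z = x" "t2 \<cdot> d = m \<cdot> (copair C (Ident C (Dom C m)) n2 \<cdot> z)"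
    using rel_saturated[OF m, of "Ident C (Dom C m)" d x] d x by auto
  have "p \<cdot> (copair C (Ident C (Dom C m)) n1 \<cdot> z) = p \<cdot> (copair C (Ident C (Dom C m)) n2 \<cdot> z)"
    using z(1-3) by (simp add: p_n)
  then show thesis using z(1-3,5) by (intro that[of "copair C (Ident C (Dom C m)) n2 \<cdot> z"]) (auto simp: z(4))
qed

text \<open>Two arrows into \<open>A + N\<close> with the same \<open>t1\<close> form a point of the kernel pair of the split epimorphism
  \<open>t1 = [1, m n1]\<close>, which condition P covers by \<open>(A + N) + P2\<close>, with \<open>P2\<close> the pullback of \<open>t1\<close> along
  \<open>m n1\<close>; the relation is checked on the two summands.\<close>

lemma rel_euclid:
  assumes yx: "rel y x" and yz: "rel y z"
  shows "rel x z"
proof -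
  note a = rel_arr[OF yx] rel_arr[OF yz]
  have r': "r1 \<in> Arr C" "r2 \<in> Arr C" "Dom C r1 = Dom C r2" by auto
  obtain c1 d1 where c1: "regular_epi C c1" "c1 \<in> Arr C" "Cod C c1 = Dom C y" "d1 \<in> Arr C" "Dom C d1 = Dom C c1"
    "Cod C d1 = coprod C A N" "t1 \<cdot> d1 = y \<cdot> c1" "t2 \<cdot> d1 = x \<cdot> c1"
    using rel_cover[OF yx] .
  have "rel (y \<cdot> c1) (z \<cdot> c1)" by (rule related_comp[OF yz]) (use c1 in auto)
  then obtain c2 d2 where c2: "regular_epi C c2" "c2 \<in> Arr C" "Cod C c2 = Dom C c1" "d2 \<in> Arr C"
    "Dom C d2 = Dom C c2" "Cod C d2 = coprod C A N" "t1 \<cdot> d2 = (y \<cdot> c1) \<cdot> c2" "t2 \<cdot> d2 = (z \<cdot> c1) \<cdot> c2"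
    using c1 a by (elim rel_cover) auto
  have re: "regular_epi C t1"
    by (rule split_epi_regular[of _ "inj_left C A N"]) auto
  obtain \<pi>1 \<pi>2 where pi: "is_pullback C \<pi>1 \<pi>2 (m \<cdot> n1) t1"
    using ex_pb[of "m \<cdot> n1" t1] by auto
  note piD = pullbackD[OF pi]
  have piD': "Cod C \<pi>1 = N" "Cod C \<pi>2 = coprod C A N" "Dom C \<pi>1 = Dom C \<pi>2" "\<pi>1 \<in> Arr C" "\<pi>2 \<in> Arr C"
    using piD by auto
  have t1d: "t1 \<cdot> (d1 \<cdot> c2) = t1 \<cdot> d2"
    using reassoc[OF c1(7), of c2] c1 c2 a by auto
  obtain c3 d3 where c3: "regular_epi C c3" "c3 \<in> Arr C" "Cod C c3 = Dom C c2" "d3 \<in> Arr C" "Dom C d3 = Dom C c3"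
    "Cod C d3 = coprod C (coprod C A N) (Dom C \<pi>1)" "coprod_arr C t1 \<pi>1 \<cdot> d3 = (d1 \<cdot> c2) \<cdot> c3"
    "copair C (Ident C (coprod C A N)) \<pi>2 \<cdot> d3 = d2 \<cdot> c3"
  proof (rule cover_copair[OF re pullback_trivial(2) pi])
    show "copair C (Ident C A) (m \<cdot> n1) \<cdot> (d1 \<cdot> c2) = t1 \<cdot> d2"
      using t1d by (simp only: t1_def)
  qed (use that c1 c2 in simp_all)
  \<comment> \<open>On the summand \<open>P2\<close>, \<open>t1\<close> sends \<open>\<pi>2\<close>
    into \<open>m\<close>, so \<open>t2\<close> does too, with value \<open>m w\<close>. Both
    \<open>n2 \<pi>1\<close> and \<open>w\<close> have the same image under \<open>p\<close> as
    \<open>n1 \<pi>1\<close>, so they form a point \<open>v\<close> of \<open>N\<close>.\<close>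
  have "t1 \<cdot> \<pi>2 = m \<cdot> (n1 \<cdot> \<pi>1)" using piD piD' by simp
  then obtain w where w: "w \<in> Arr C" "Dom C w = Dom C \<pi>2" "Cod C w = Dom C m" "t2 \<cdot> \<pi>2 = m \<cdot> w"
    "p \<cdot> (n1 \<cdot> \<pi>1) = p \<cdot> w"
    using rel_saturated_m[of \<pi>2 "n1 \<cdot> \<pi>1"] piD' by auto
  have "p \<cdot> (n2 \<cdot> \<pi>1) = p \<cdot> w" using w(5) reassoc[OF p_n, of \<pi>1] piD' by simp
  then obtain v where v: "v \<in> Arr C" "Dom C v = Dom C \<pi>2" "Cod C v = N" "n1 \<cdot> v = n2 \<cdot> \<pi>1" "n2 \<cdot> v = w"
    using pullbackE[OF n, of "n2 \<cdot> \<pi>1" w] piD' w(1-3) by auto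
  have "rel (t1 \<cdot> (inj_right C A N \<cdot> v)) (t2 \<cdot> (inj_right C A N \<cdot> v))"
    by (rule rel_t) (use v in simp_all)
  then have rel2: "rel (m \<cdot> (n2 \<cdot> \<pi>1)) (t2 \<cdot> \<pi>2)" using v w by simp
  have rel1: "rel t1 t2" using rel_t[of "Ident C (coprod C A N)"] by simp
  \<comment> \<open>Applying \<open>t2\<close> to the two components of the covering point gives
    \<open>[t1, m n2 \<pi>1]\<close> and \<open>[t2, t2 \<pi>2]\<close>; these are related summand
    by summand.\<close>
  have "rel (copair C t1 (m \<cdot> (n2 \<cdot> \<pi>1)) \<cdot> d3) (copair C t2 (t2 \<cdot> \<pi>2) \<cdot> d3)"
    by (rule related_comp[OF related_copair[OF rel1 rel2 r'] r']) (use c3 piD' in simp_all)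
  moreover have "copair C t1 (m \<cdot> (n2 \<cdot> \<pi>1)) \<cdot> d3 = t2 \<cdot> (coprod_arr C t1 \<pi>1 \<cdot> d3)"
    using c3(4-6) piD' by simp
  moreover have "copair C t2 (t2 \<cdot> \<pi>2) \<cdot> d3 = t2 \<cdot> (copair C (Ident C (coprod C A N)) \<pi>2 \<cdot> d3)"
    using c3(4-6) piD' by simp
  ultimately have "rel (t2 \<cdot> ((d1 \<cdot> c2) \<cdot> c3)) (t2 \<cdot> (d2 \<cdot> c3))" using c3(7,8) by simp
  moreover have "t2 \<cdot> ((d1 \<cdot> c2) \<cdot> c3) = ((x \<cdot> c1) \<cdot> c2) \<cdot> c3"
    using reassoc[OF c1(8), of "c2 \<cdot> c3"] c1(2-6) c2(2-6) c3(2-6) a by simp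
  moreover have "t2 \<cdot> (d2 \<cdot> c3) = ((z \<cdot> c1) \<cdot> c2) \<cdot> c3"
    using reassoc[OF c2(8), of c3] c1(2-6) c2(2-6) c3(2-6) a by simp
  ultimately have "rel (((x \<cdot> c1) \<cdot> c2) \<cdot> c3) (((z \<cdot> c1) \<cdot> c2) \<cdot> c3)" by simp
  then have "rel ((x \<cdot> c1) \<cdot> c2) ((z \<cdot> c1) \<cdot> c2)"
    by (rule related_descend[OF r(1) c3(1)]) (use a c1(2-6) c2(2-6) c3(2-6) in simp_all)
  then have "rel (x \<cdot> c1) (z \<cdot> c1)"
    by (rule related_descend[OF r(1) c2(1)]) (use a c1(2-6) c2(2-6) in simp_all)
  then show "rel x z"
    by (rule related_descend[OF r(1) c1(1)]) (use a c1(2-6) in simp_all)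
qed

lemma equivalence_relation: "internal_equivalence_relation C A (Cod C e) r1 r2"
proof -
  have r12: "rel r1 r2" unfolding related_def by (intro bexI[of _ "Ident C (Cod C e)"]) auto
  have 1: "rel (Ident C A) (Ident C A)" using rel_t[of "inj_left C A N"] by simp
  have 2: "rel r2 r1" using rel_sym[OF r12] .
  have 3: "\<exists>t\<in>hom C (Dom C h) (Cod C e). r1 \<cdot> t = r1 \<cdot> h \<and> r2 \<cdot> t = r2 \<cdot> k"
    if "is_pullback C h k r2 r1" for h k
  proof -
    note hk = pullbackD[OF that]
    \<comment> \<open>Transitivity from symmetry and \<open>rel_euclid\<close>, with the shared
      element \<open>r2 \<cdot> h = r1 \<cdot> k\<close> in the middle.\<close>
    have a: "rel (r2 \<cdot> h) (r1 \<cdot> h)" by (rule related_comp[OF 2]) (use hk in simp_all)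
    have "rel (r1 \<cdot> k) (r2 \<cdot> k)" by (rule related_comp[OF r12]) (use hk in simp_all)
    then have b: "rel (r2 \<cdot> h) (r2 \<cdot> k)" by (simp only: hk(9))
    obtain t where t: "t \<in> Arr C" "Cod C t = Dom C r1" "r1 \<cdot> t = r1 \<cdot> h" "r2 \<cdot> t = r2 \<cdot> k"
      using rel_euclid[OF a b] unfolding related_def by blast
    have "Dom C (r1 \<cdot> t) = Dom C (r1 \<cdot> h)" by (simp only: t(3))
    then have "Dom C t = Dom C h" using hk t(1,2) by simp
    then show ?thesis using t by (intro bexI[of _ t]) auto
  qed
  obtain i where i: "i \<in> Arr C" "Cod C i = Cod C e" "r1 \<cdot> i = Ident C A" "r2 \<cdot> i = Ident C A"
    using 1 unfolding related_def by auto
  have "Dom C (r1 \<cdot> i) = A" by (simp only: i(3)) simp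
  then have i': "Dom C i = A" using i(1,2) by simp
  obtain s where s: "s \<in> Arr C" "Cod C s = Cod C e" "r1 \<cdot> s = r2" "r2 \<cdot> s = r1"
    using 2 unfolding related_def by auto
  have "Dom C (r1 \<cdot> s) = Dom C r2" by (simp only: s(3))
  then have s': "Dom C s = Cod C e" using s(1,2) by simp
  show ?thesis
    unfolding internal_equivalence_relation_def
  proof (intro conjI)
    show "\<exists>d\<in>hom C A (Cod C e). r1 \<cdot> d = Ident C A \<and> r2 \<cdot> d = Ident C A"
      using i i' by (intro bexI[of _ i]) auto
    show "\<exists>s\<in>hom C (Cod C e) (Cod C e). r1 \<cdot> s = r2 \<and> r2 \<cdot> s = r1"
      using s s' by (intro bexI[of _ s]) auto
  qed (use r(1) 3 in auto)
qed

text \<open>Exactness makes the relation the kernel pair of some \<open>f\<close>. Since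
  \<open>f\<close> factors through the coequalizer \<open>q\<close>, elements identified by
  \<open>q\<close> are identified by \<open>f\<close> and hence related.\<close>

lemma quotient:
  obtains q where "is_coequalizer C r1 r2 q"
    "\<And>x y. x \<in> Arr C \<Longrightarrow> y \<in> Arr C \<Longrightarrow> Dom C x = Dom C y \<Longrightarrow> Cod C x = A \<Longrightarrow> Cod C y = A \<Longrightarrow> q \<cdot> x = q \<cdot> y \<Longrightarrow> rel x y"
proof -
  obtain f where f: "is_pullback C r1 r2 f f"
    using exact equivalence_relation unfolding exact_category_def is_kernel_pair_def by blast
  note fD = pullbackD[OF f]
  obtain q where q: "is_coequalizer C r1 r2 q"
    using regular f unfolding regular_category_def is_kernel_pair_def by blast
  then have q': "q \<in> Arr C" "Dom C q = A" by (auto simp: is_coequalizer_def)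
  obtain k where k: "k \<in> Arr C" "Dom C k = Cod C q" "Cod C k = Cod C f" "k \<cdot> q = f"
    using coequalizerE[OF q, of f] fD q' by auto
  show thesis
  proof (rule that[OF q])
    fix x y assume xy: "x \<in> Arr C" "y \<in> Arr C" "Dom C x = Dom C y" "Cod C x = A" "Cod C y = A" "q \<cdot> x = q \<cdot> y"
    have "f \<cdot> x = f \<cdot> y" using reassoc[OF k(4), of x] reassoc[OF k(4), of y] xy q' k by simp
    then obtain w where "w \<in> Arr C" "Cod C w = Dom C r2" "r1 \<cdot> w = x" "r2 \<cdot> w = y"
      using pullbackE[OF f, of x y] xy fD by auto
    then show "rel x y" unfolding related_def by auto
  qed
qed

end

section \<open>Pushouts of monomorphisms along regular epimorphisms\<close>

context exact_category_P
begin

text \<open>The pushout is the quotient \<open>q\<close> of \<open>Cod C m\<close> by the gluing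
  relation. The last conclusion says that each subobject \<open>u\<close> containing
  \<open>m\<close> is saturated for \<open>q\<close>; in \<open>mono_equalizer\<close> this detects
  which elements come from \<open>m\<close>.\<close>

lemma pushout_mono_regular_epi:
  assumes m: "mono_arr C m" and p: "regular_epi C p" and dom_p: "Dom C p = Dom C m"
  obtains q b where "q \<in> Arr C" "Dom C q = Cod C m" "b \<in> Arr C" "Dom C b = Cod C p" "Cod C b = Cod C q"
    "q \<cdot> m = b \<cdot> p" "mono_arr C b"
    "\<And>f g. f \<in> Arr C \<Longrightarrow> g \<in> Arr C \<Longrightarrow> Dom C f = Cod C m \<Longrightarrow> Dom C g = Cod C p \<Longrightarrow> Cod C f = Cod C g \<Longrightarrow>
      f \<cdot> m = g \<cdot> p \<Longrightarrow> \<exists>!k. k \<in> hom C (Cod C q) (Cod C f) \<and> k \<cdot> q = f \<and> k \<cdot> b = g"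
    "\<And>u k x y. mono_arr C u \<Longrightarrow> k \<in> Arr C \<Longrightarrow> Cod C u = Cod C m \<Longrightarrow> Dom C k = Dom C m \<Longrightarrow>
      Cod C k = Dom C u \<Longrightarrow> u \<cdot> k = m \<Longrightarrow> x \<in> Arr C \<Longrightarrow> y \<in> Arr C \<Longrightarrow> Dom C x = Dom C y \<Longrightarrow>
      Cod C x = Dom C u \<Longrightarrow> Cod C y = Cod C m \<Longrightarrow> q \<cdot> (u \<cdot> x) = q \<cdot> y \<Longrightarrow>
      \<exists>z. z \<in> hom C (Dom C y) (Dom C u) \<and> u \<cdot> z = y"
proof -
  have mp: "m \<in> Arr C" "p \<in> Arr C" using m p regular_epi_arr by (auto simp: mono_arr_def)
  obtain n1 n2 where n: "is_pullback C n1 n2 p p" using ex_pb[of p p] mp by auto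
  note nD = pullbackD[OF n]
  obtain e r1 r2 where "regular_epi C e" "e \<in> Arr C" "Dom C e = Dom C (copair C (Ident C (Cod C m)) (m \<cdot> n1))"
    "jointly_monic C r1 r2"
    "r1 \<in> hom C (Cod C e) (Cod C m)" "r2 \<in> hom C (Cod C e) (Cod C m)"
    "r1 \<cdot> e = copair C (Ident C (Cod C m)) (m \<cdot> n1)" "r2 \<cdot> e = copair C (Ident C (Cod C m)) (m \<cdot> n2)"
    by (rule joint_image[of "copair C (Ident C (Cod C m)) (m \<cdot> n1)" "copair C (Ident C (Cod C m)) (m \<cdot> n2)"])
      (use nD mp dom_p in auto)
  then interpret gluing C m p n1 n2 e r1 r2
    using m p dom_p n nD mp by unfold_locales auto
  obtain q where q: "is_coequalizer C r1 r2 q"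
    and rel: "\<And>x y. x \<in> Arr C \<Longrightarrow> y \<in> Arr C \<Longrightarrow> Dom C x = Dom C y \<Longrightarrow> Cod C x = A \<Longrightarrow> Cod C y = A \<Longrightarrow> q \<cdot> x = q \<cdot> y \<Longrightarrow> rel x y"
    by (rule quotient) (rule that)
  have q': "q \<in> Arr C" "Dom C q = A" "q \<cdot> r1 = q \<cdot> r2" using q by (auto simp: is_coequalizer_def)
  \<comment> \<open>Restricted to the summand \<open>N\<close>, this says that \<open>q m\<close>
    coequalizes the kernel pair of \<open>p\<close>, so \<open>q m\<close> descends along
    \<open>p\<close> to \<open>b\<close>.\<close>
  have "q \<cdot> t1 = q \<cdot> t2" using reassoc[OF q'(3), of e] q'(1,2) by (simp add: rt)
  then have "(q \<cdot> t1) \<cdot> inj_right C A N = (q \<cdot> t2) \<cdot> inj_right C A N" by simp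
  then have "(q \<cdot> m) \<cdot> n1 = (q \<cdot> m) \<cdot> n2" using q' by simp
  then obtain b where b: "b \<in> Arr C" "Dom C b = Cod C p" "Cod C b = Cod C q" "b \<cdot> p = q \<cdot> m"
    using regular_epi_factor[OF p n, of "q \<cdot> m"] q' by auto
  show thesis
  proof (rule that[of q b])
    show "mono_arr C b"
      unfolding mono_arr_def
    proof (intro conjI allI impI)
      fix u v assume "u \<in> Arr C \<and> v \<in> Arr C \<and> Dom C u = Dom C v \<and> Cod C u = Dom C b \<and>
        Cod C v = Dom C b \<and> b \<cdot> u = b \<cdot> v"
      then have uv: "u \<in> Arr C" "v \<in> Arr C" "Dom C u = Dom C v" "Cod C u = Cod C p" "Cod C v = Cod C p"
        "b \<cdot> u = b \<cdot> v" using b by auto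
      obtain c x where c: "regular_epi C c" "c \<in> Arr C" "Cod C c = Dom C v" "x \<in> Arr C" "Dom C x = Dom C c"
        "Cod C x = Dom C m" "u \<cdot> c = p \<cdot> x"
        using cover_pullback[OF p, of u] uv by auto
      obtain c' y where c': "regular_epi C c'" "c' \<in> Arr C" "Cod C c' = Dom C c" "y \<in> Arr C" "Dom C y = Dom C c'"
        "Cod C y = Dom C m" "(v \<cdot> c) \<cdot> c' = p \<cdot> y"
        using cover_pullback[OF p, of "v \<cdot> c"] uv c by auto
      have "q \<cdot> (m \<cdot> (x \<cdot> c')) = b \<cdot> (u \<cdot> (c \<cdot> c'))"
        using reassoc[OF b(4), of "x \<cdot> c'"] reassoc[OF c(7), of c'] b(1-3) q' uv(1-5) c(1-6) c'(1-6) by simp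
      also have "\<dots> = b \<cdot> (v \<cdot> (c \<cdot> c'))"
        using reassoc[OF uv(6), of "c \<cdot> c'"] b(1-3) uv(1-5) c(1-6) c'(1-6) by simp
      also have "\<dots> = q \<cdot> (m \<cdot> y)"
        using reassoc[OF b(4), of y] c'(7) b(1-3) q' uv(1-5) c(1-6) c'(1-6) by simp
      \<comment> \<open>Elements identified by \<open>b\<close> lift to elements of \<open>m\<close>
        that are related; by \<open>rel_saturated_m\<close> these have equal images under
        \<open>p\<close> over a further cover, and the covers are then cancelled one by one.\<close>
      finally have "rel (m \<cdot> (x \<cdot> c')) (m \<cdot> y)"
        by (intro rel) (use c(1-6) c'(1-6) in simp_all)
      then obtain c3 d3 where c3: "regular_epi C c3" "c3 \<in> Arr C" "Cod C c3 = Dom C c'" "d3 \<in> Arr C"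
        "Dom C d3 = Dom C c3" "Cod C d3 = coprod C A N" "t1 \<cdot> d3 = m \<cdot> (x \<cdot> (c' \<cdot> c3))" "t2 \<cdot> d3 = m \<cdot> (y \<cdot> c3)"
        using c(1-6) c'(1-6) by (elim rel_cover) simp
      obtain y' where y': "y' \<in> Arr C" "Dom C y' = Dom C d3" "Cod C y' = Dom C m" "t2 \<cdot> d3 = m \<cdot> y'"
        "p \<cdot> (x \<cdot> (c' \<cdot> c3)) = p \<cdot> y'"
        by (rule rel_saturated_m[of d3 "x \<cdot> (c' \<cdot> c3)"]) (use c(1-6) c'(1-6) c3 in simp_all)
      have "y' = y \<cdot> c3"
        by (rule monoD[OF m]) (use y' c'(1-6) c3 in simp_all)
      then have "((u \<cdot> c) \<cdot> c') \<cdot> c3 = ((v \<cdot> c) \<cdot> c') \<cdot> c3"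
        using y'(5) reassoc[OF c(7), of "c' \<cdot> c3"] reassoc[OF c'(7), of c3] uv(1-5) c(1-6) c'(1-6) c3(1-6)
        by simp
      then have "(u \<cdot> c) \<cdot> c' = (v \<cdot> c) \<cdot> c'"
        by (rule cover_eq[OF c3(1)]) (use uv(1-5) c(1-6) c'(1-6) c3(1-6) in simp_all)
      then have "u \<cdot> c = v \<cdot> c"
        by (rule cover_eq[OF c'(1)]) (use uv(1-5) c(1-6) c'(1-6) in simp_all)
      then show "u = v"
        by (rule cover_eq[OF c(1)]) (use uv(1-5) c(1-6) in simp_all)
    qed (rule b)
  next
    fix f g assume fg: "f \<in> Arr C" "g \<in> Arr C" "Dom C f = A" "Dom C g = Cod C p" "Cod C f = Cod C g"
      "f \<cdot> m = g \<cdot> p"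
    have "f \<cdot> (m \<cdot> n1) = f \<cdot> (m \<cdot> n2)"
      using reassoc[OF fg(6), of n1] reassoc[OF fg(6), of n2] p_n fg(1-5) by simp
    \<comment> \<open>Both sides restrict to \<open>f\<close> on the summand \<open>A\<close>; on
      \<open>N\<close> they agree because \<open>f m = g p\<close> and \<open>p\<close> identifies
      \<open>n1\<close> and \<open>n2\<close>.\<close>
    then have "f \<cdot> t1 = f \<cdot> t2" unfolding t1_def t2_def using fg(1-5) by simp
    then have "(f \<cdot> r1) \<cdot> e = (f \<cdot> r2) \<cdot> e" using fg(1-5) by (simp add: rt)
    then have "f \<cdot> r1 = f \<cdot> r2" by (rule cover_eq[OF e(1)]) (use fg(1-5) in simp_all)
    then obtain k where k: "k \<in> Arr C" "Dom C k = Cod C q" "Cod C k = Cod C f" "k \<cdot> q = f"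
      using coequalizerE[OF q, of f] fg(1-5) q' by auto
    have "(k \<cdot> b) \<cdot> p = g \<cdot> p"
      using reassoc[OF k(4), of m] b k(1-3) q'(1,2) fg by simp
    then have "k \<cdot> b = g" by (rule cover_eq[OF p]) (use b(1-3) k(1-3) fg(1-5) in simp_all)
    with k show "\<exists>!k. k \<in> hom C (Cod C q) (Cod C f) \<and> k \<cdot> q = f \<and> k \<cdot> b = g"
      using epiD[OF coequalizer_epi[OF q]] by (intro ex1I[of _ k]) auto
  next
    fix u k x y assume u: "mono_arr C u" and k: "k \<in> Arr C" "Cod C u = A" "Dom C k = Dom C m"
      "Cod C k = Dom C u" "u \<cdot> k = m" and xy: "x \<in> Arr C" "y \<in> Arr C" "Dom C x = Dom C y"
      "Cod C x = Dom C u" "Cod C y = A" "q \<cdot> (u \<cdot> x) = q \<cdot> y"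
    have uA: "u \<in> Arr C" using u by (simp add: mono_arr_def)
    \<comment> \<open>Over a cover \<open>c\<close> the saturation of \<open>u\<close> gives a
      factorization of \<open>y c\<close> through \<open>u\<close>; \<open>regular_epi_fill\<close>
      then descends it to \<open>y\<close>.\<close>
    have "rel (u \<cdot> x) y" by (rule rel) (use xy uA k in simp_all)
    then obtain c d where c: "regular_epi C c" "c \<in> Arr C" "Cod C c = Dom C y" "d \<in> Arr C" "Dom C d = Dom C c"
      "Cod C d = coprod C A N" "t1 \<cdot> d = u \<cdot> (x \<cdot> c)" "t2 \<cdot> d = y \<cdot> c"
      using xy(1-5) uA by (elim rel_cover) simp
    obtain z where z: "z \<in> Arr C" "Dom C z = Dom C d" "Cod C z = coprod C (Dom C u) N"
      "t2 \<cdot> d = u \<cdot> (copair C (Ident C (Dom C u)) (k \<cdot> n2) \<cdot> z)"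
      by (rule rel_saturated[OF u uA k(2,1,3,4,5), of d "x \<cdot> c"]) (use c xy(1-5) in simp_all)
    show "\<exists>z. z \<in> hom C (Dom C y) (Dom C u) \<and> u \<cdot> z = y"
    proof (rule regular_epi_fill[OF c(1) u, of y "copair C (Ident C (Dom C u)) (k \<cdot> n2) \<cdot> z"])
      show "y \<cdot> c = u \<cdot> (copair C (Ident C (Dom C u)) (k \<cdot> n2) \<cdot> z)"
        using z(4) c(8) by simp
    qed (use xy(1-5) c(1-6) z(1-3) k(1-4) uA in auto)
  qed (use q' b in auto)
qed

section \<open>Monomorphisms and epimorphisms are regular\<close>

lemma pullback_sym: "is_pullback C t l r b \<Longrightarrow> is_pullback C l t b r"
  unfolding is_pullback_def comm_square_def by metis

lemma mono_ident: "A \<in> Obj C \<Longrightarrow> mono_arr C (Ident C A)"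
  by (rule split_mono[of "Ident C A"]) auto

text \<open>An arrow is mono exactly when identities form its kernel pair; by (b) such pullback
  squares are closed under binary coproducts.\<close>

lemma mono_coprod_arr:
  assumes "mono_arr C m" "mono_arr C m'"
  shows "mono_arr C (coprod_arr C m m')"
proof -
  have pb: "is_pullback C (Ident C (Dom C f)) (Ident C (Dom C f)) f f" if f: "mono_arr C f" for f
  proof -
    have "f \<in> Arr C" using f by (simp add: mono_arr_def)
    then show ?thesis using monoD[OF f] by (intro pullbackI) auto
  qed
  have a: "m \<in> Arr C" "m' \<in> Arr C" using assms by (simp_all add: mono_arr_def)
  let ?i = "Ident C (coprod C (Dom C m) (Dom C m'))"
  have "is_pullback C ?i ?i (coprod_arr C m m') (coprod_arr C m m')"
    using pullback_coprod_arr[OF pb[OF assms(1)] pb[OF assms(2)]] a by simp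
  note pbi = this
  show ?thesis unfolding mono_arr_def
  proof (intro conjI allI impI)
    fix u v assume uv: "u \<in> Arr C \<and> v \<in> Arr C \<and> Dom C u = Dom C v \<and> Cod C u = Dom C (coprod_arr C m m') \<and>
      Cod C v = Dom C (coprod_arr C m m') \<and> coprod_arr C m m' \<cdot> u = coprod_arr C m m' \<cdot> v"
    then obtain w where "w \<in> Arr C" "Cod C w = Dom C ?i" "?i \<cdot> w = u" "?i \<cdot> w = v"
      using pullbackE[OF pbi, of u v] by blast
    then show "u = v" by simp
  qed (use a in simp)
qed

lemma codiagonal_regular_epi: "S \<in> Obj C \<Longrightarrow> regular_epi C (copair C (Ident C S) (Ident C S))"
  by (rule split_epi_regular[of _ "inj_left C S S"]) auto

text \<open>Pushing \<open>m + m\<close> out along the codiagonal of its domain glues two copies of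
  \<open>A\<close> along \<open>m\<close>. The two inclusions into the result are
  \<open>q1, q2\<close>, and \<open>m\<close> is their equalizer.\<close>

lemma mono_equalizer:
  assumes m: "mono_arr C m"
  obtains q1 q2 where "q1 \<in> Arr C" "q2 \<in> Arr C" "Dom C q1 = Cod C m" "Dom C q2 = Cod C m"
    "Cod C q1 = Cod C q2" "q1 \<cdot> m = q2 \<cdot> m"
    "\<And>x. x \<in> Arr C \<Longrightarrow> Cod C x = Cod C m \<Longrightarrow> q1 \<cdot> x = q2 \<cdot> x \<Longrightarrow> \<exists>z. z \<in> hom C (Dom C x) (Dom C m) \<and> m \<cdot> z = x"
proof -
  let ?A = "Cod C m" and ?S = "Dom C m"
  have mA: "m \<in> Arr C" using m by (simp add: mono_arr_def)
  have S: "?S \<in> Obj C" using mA by simp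
  let ?d = "copair C (Ident C ?S) (Ident C ?S)"
  have dom: "Dom C ?d = Dom C (coprod_arr C m m)" using mA by simp
  obtain q b where q: "q \<in> Arr C" "Dom C q = Cod C (coprod_arr C m m)" "b \<in> Arr C" "Dom C b = Cod C ?d"
      "Cod C b = Cod C q" "q \<cdot> coprod_arr C m m = b \<cdot> ?d"
    and sat: "\<And>u k x y. mono_arr C u \<Longrightarrow> k \<in> Arr C \<Longrightarrow> Cod C u = Cod C (coprod_arr C m m) \<Longrightarrow>
      Dom C k = Dom C (coprod_arr C m m) \<Longrightarrow>
      Cod C k = Dom C u \<Longrightarrow> u \<cdot> k = coprod_arr C m m \<Longrightarrow> x \<in> Arr C \<Longrightarrow> y \<in> Arr C \<Longrightarrow> Dom C x = Dom C y \<Longrightarrow>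
      Cod C x = Dom C u \<Longrightarrow> Cod C y = Cod C (coprod_arr C m m) \<Longrightarrow> q \<cdot> (u \<cdot> x) = q \<cdot> y \<Longrightarrow>
      \<exists>z. z \<in> hom C (Dom C y) (Dom C u) \<and> u \<cdot> z = y"
    by (rule pushout_mono_regular_epi[OF mono_coprod_arr[OF m m] codiagonal_regular_epi[OF S] dom]) (rule that)
  have q': "Dom C q = coprod C ?A ?A" "Dom C b = ?S" using q mA by simp_all
  have "(q \<cdot> coprod_arr C m m) \<cdot> inj_left C ?S ?S = (b \<cdot> ?d) \<cdot> inj_left C ?S ?S"
    "(q \<cdot> coprod_arr C m m) \<cdot> inj_right C ?S ?S = (b \<cdot> ?d) \<cdot> inj_right C ?S ?S" by (simp_all only: q(6))
  then have qm: "q \<cdot> (inj_left C ?A ?A \<cdot> m) = b" "q \<cdot> (inj_right C ?A ?A \<cdot> m) = b"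
    using q(1,3,5) q' mA by simp_all
  show thesis
  proof (rule that[of "q \<cdot> inj_left C ?A ?A" "q \<cdot> inj_right C ?A ?A"])
    fix x assume x: "x \<in> Arr C" "Cod C x = ?A" "(q \<cdot> inj_left C ?A ?A) \<cdot> x = (q \<cdot> inj_right C ?A ?A) \<cdot> x"
    let ?u = "coprod_arr C (Ident C ?A) m"
    have "mono_arr C (Ident C ?A)" using mA by (intro mono_ident) simp
    then have u: "mono_arr C ?u" using mono_coprod_arr m by blast
    \<comment> \<open>The subobject \<open>1 + m\<close> of \<open>A + A\<close> contains
      \<open>m + m\<close> and the left copy of \<open>x\<close>. It is saturated for
      \<open>q\<close>, which identifies the two copies of \<open>x\<close>, so it contains the
      right copy too.\<close>
    have "\<exists>z. z \<in> hom C (Dom C (inj_right C ?A ?A \<cdot> x)) (Dom C ?u) \<and> ?u \<cdot> z = inj_right C ?A ?A \<cdot> x"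
      by (rule sat[OF u, of "coprod_arr C m (Ident C ?S)" "inj_left C ?A ?S \<cdot> x"]) (use q q' mA x in simp_all)
    then obtain z where z: "z \<in> Arr C" "Dom C z = Dom C x" "Cod C z = coprod C ?A ?S"
      "?u \<cdot> z = inj_right C ?A ?A \<cdot> x"
      using mA x by auto
    (* The pullback of 1 + m along m + 1 stands in for the pullback along a coproduct injection, which
       need not be S because coproducts are not assumed disjoint. *)
    have pb: "is_pullback C (coprod_arr C m (Ident C ?S)) (coprod_arr C (Ident C ?S) m) ?u
        (coprod_arr C m (Ident C ?A))"
      using pullback_coprod_arr[OF pullback_trivial(2)[OF mA refl refl] pullback_trivial(1)[OF mA refl refl]] .
    obtain w where w: "w \<in> Arr C" "Dom C w = Dom C z" "Cod C w = coprod C ?S ?S"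
      "coprod_arr C (Ident C ?S) m \<cdot> w = inj_right C ?S ?A \<cdot> x"
      by (rule pullbackE[OF pb, of z "inj_right C ?S ?A \<cdot> x"]) (use z mA x in simp_all)
    \<comment> \<open>\<open>[m, 1] (1 + m) = m [1, 1]\<close>, while \<open>[m, 1]\<close> sends
      the right copy of \<open>x\<close> to \<open>x\<close>; this exhibits \<open>x\<close> as a
      composite with \<open>m\<close>.\<close>
    have "copair C m (Ident C ?A) \<cdot> (coprod_arr C (Ident C ?S) m \<cdot> w) = m \<cdot> (?d \<cdot> w)"
      using w(1-3) mA by simp
    then have "m \<cdot> (?d \<cdot> w) = x" unfolding w(4) using x mA by simp
    then show "\<exists>z. z \<in> hom C (Dom C x) ?S \<and> m \<cdot> z = x"
      using w(1-3) z(2) mA by (intro exI[of _ "?d \<cdot> w"]) simp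
  qed (use q q' qm mA in simp_all)
qed

text \<open>If \<open>m\<close> is also epi, the two arrows that it equalizes coincide, so the
  identity factors through \<open>m\<close>.\<close>

lemma epi_mono_split:
  assumes m: "mono_arr C m" and e: "epi_arr C m"
  obtains i where "i \<in> Arr C" "Dom C i = Cod C m" "Cod C i = Dom C m" "m \<cdot> i = Ident C (Cod C m)"
    "i \<cdot> m = Ident C (Dom C m)"
proof -
  have mA: "m \<in> Arr C" using m by (simp add: mono_arr_def)
  obtain q1 q2 where q: "q1 \<in> Arr C" "q2 \<in> Arr C" "Dom C q1 = Cod C m" "Dom C q2 = Cod C m"
    "Cod C q1 = Cod C q2" "q1 \<cdot> m = q2 \<cdot> m"
    and eq: "\<And>x. x \<in> Arr C \<Longrightarrow> Cod C x = Cod C m \<Longrightarrow> q1 \<cdot> x = q2 \<cdot> x \<Longrightarrow>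
      \<exists>z. z \<in> hom C (Dom C x) (Dom C m) \<and> m \<cdot> z = x"
    by (rule mono_equalizer[OF m]) (rule that)
  have "q1 = q2" by (rule epiD[OF e]) (use q in simp_all)
  then obtain i where i: "i \<in> Arr C" "Dom C i = Cod C m" "Cod C i = Dom C m" "m \<cdot> i = Ident C (Cod C m)"
    using eq[of "Ident C (Cod C m)"] mA by auto
  have "i \<cdot> m = Ident C (Dom C m)"
    by (rule monoD[OF m]) (use i mA reassoc[OF i(4), of m] in simp_all)
  with i show thesis by (rule that)
qed

text \<open>The mono part of the image factorization of an epimorphism is again epi, hence
  invertible, so \<open>q\<close> is a coequalizer of the same pair as its regular epi part.\<close>

lemma epi_regular:
  assumes q: "epi_arr C q"
  shows "regular_epi C q"
proof -
  have qA: "q \<in> Arr C" using q by (simp add: epi_arr_def)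
  obtain e m where e: "regular_epi C e" and m: "mono_arr C m" and em: "m \<in> Arr C" "e \<in> Arr C"
    "Dom C m = Cod C e" "Dom C e = Dom C q" "Cod C m = Cod C q" "m \<cdot> e = q"
    using image_factorization[OF qA] .
  have "epi_arr C m"
    unfolding epi_arr_def
  proof (intro conjI allI impI)
    fix u v assume "u \<in> Arr C \<and> v \<in> Arr C \<and> Cod C u = Cod C v \<and> Dom C u = Cod C m \<and>
      Dom C v = Cod C m \<and> u \<cdot> m = v \<cdot> m"
    then have uv: "u \<in> Arr C" "v \<in> Arr C" "Cod C u = Cod C v" "Dom C u = Cod C m" "Dom C v = Cod C m"
      "u \<cdot> m = v \<cdot> m" by blast+
    have "u \<cdot> q = v \<cdot> q" using reassoc[OF uv(6), of e] uv(1-5) em by simp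
    then show "u = v" by (rule epiD[OF q]) (use uv(1-5) em in simp_all)
  qed (rule em)
  then obtain i where i: "i \<in> Arr C" "Dom C i = Cod C m" "Cod C i = Dom C m" "i \<cdot> m = Ident C (Dom C m)"
    using epi_mono_split[OF m] by metis
  obtain a b where ab: "is_coequalizer C a b e" using e unfolding regular_epi_def by blast
  then have ab': "a \<in> Arr C" "b \<in> Arr C" "Dom C a = Dom C b" "Cod C a = Dom C q" "Cod C b = Dom C q"
    "e \<cdot> a = e \<cdot> b" using em by (auto simp: is_coequalizer_def)
  have "is_coequalizer C a b q"
    unfolding is_coequalizer_def
  proof (intro conjI ballI impI)
    show "q \<cdot> a = q \<cdot> b" using ab' em(1-5) reassoc[OF em(6), of a] reassoc[OF em(6), of b] by simp
    fix h assume h: "h \<in> Arr C" "Dom C h = Cod C a \<and> h \<cdot> a = h \<cdot> b"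
    then obtain k where k: "k \<in> Arr C" "Dom C k = Cod C e" "Cod C k = Cod C h" "k \<cdot> e = h"
      using coequalizerE[OF ab, of h] ab' em by auto
    have "(k \<cdot> i) \<cdot> q = h"
    proof -
      have "i \<cdot> q = e" using reassoc[OF i(4), of e] i em by simp
      then show ?thesis using i k em(1-5) qA by simp
    qed
    then have kiq: "k \<cdot> i \<in> hom C (Cod C q) (Cod C h) \<and> (k \<cdot> i) \<cdot> q = h"
      using i k em(1-5) by simp
    then show "\<exists>!k. k \<in> hom C (Cod C q) (Cod C h) \<and> k \<cdot> q = h"
    proof (rule ex1I)
      fix k' assume k': "k' \<in> hom C (Cod C q) (Cod C h) \<and> k' \<cdot> q = h"
      then have "k' \<cdot> q = (k \<cdot> i) \<cdot> q" using kiq by metis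
      then show "k' = k \<cdot> i" by (rule epiD[OF q]) (use k' kiq in simp_all)
    qed
  qed (use ab' qA in simp_all)
  then show ?thesis unfolding regular_epi_def by blast
qed

section \<open>Reflexive corelations\<close>

lemma op_simps [simp]:
  "Obj (op_cat C) = Obj C" "Arr (op_cat C) = Arr C" "Dom (op_cat C) = Cod C" "Cod (op_cat C) = Dom C"
  "Ident (op_cat C) = Ident C" "Comp (op_cat C) g f = f \<cdot> g" "hom (op_cat C) a b = hom C b a"
  by (auto simp: op_cat_def hom_def)

lemma pushoutI:
  assumes "t \<in> Arr C" "l \<in> Arr C" "r \<in> Arr C" "b \<in> Arr C" "Dom C t = Dom C l" "Dom C r = Cod C t"
    "Dom C b = Cod C l" "Cod C r = Cod C b" "r \<cdot> t = b \<cdot> l"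
  and ex1: "\<And>u v. u \<in> Arr C \<Longrightarrow> v \<in> Arr C \<Longrightarrow> Cod C u = Cod C v \<Longrightarrow> Dom C u = Cod C t \<Longrightarrow> Dom C v = Cod C l \<Longrightarrow>
    u \<cdot> t = v \<cdot> l \<Longrightarrow> \<exists>!w. w \<in> hom C (Cod C r) (Cod C u) \<and> w \<cdot> r = u \<and> w \<cdot> b = v"
  shows "is_pushout C t l r b"
  unfolding is_pushout_def is_pullback_def
proof (intro conjI allI impI)
  show "comm_square (op_cat C) r b t l" using assms(1-9) by (simp add: comm_square_def)
  fix u v assume "comm_square (op_cat C) u v t l"
  then have "u \<in> Arr C" "v \<in> Arr C" "Cod C u = Cod C v" "Dom C u = Cod C t" "Dom C v = Cod C l" "u \<cdot> t = v \<cdot> l"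
    by (simp_all add: comm_square_def)
  from ex1[OF this] show "\<exists>!w. w \<in> hom (op_cat C) (Dom (op_cat C) u) (Dom (op_cat C) r) \<and>
      Comp (op_cat C) r w = u \<and> Comp (op_cat C) b w = v"
    unfolding op_simps .
qed

lemma pushoutD:
  assumes "is_pushout C t l r b"
  shows "t \<in> Arr C" "l \<in> Arr C" "r \<in> Arr C" "b \<in> Arr C" "Dom C t = Dom C l" "Dom C r = Cod C t"
    "Dom C b = Cod C l" "Cod C r = Cod C b" "r \<cdot> t = b \<cdot> l"
proof -
  have "comm_square (op_cat C) r b t l" using assms unfolding is_pushout_def is_pullback_def by blast
  then show "t \<in> Arr C" "l \<in> Arr C" "r \<in> Arr C" "b \<in> Arr C" "Dom C t = Dom C l" "Dom C r = Cod C t"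
    "Dom C b = Cod C l" "Cod C r = Cod C b" "r \<cdot> t = b \<cdot> l"
    by (simp_all add: comm_square_def)
qed

lemma pushout_univ:
  assumes "is_pushout C t l r b" "u \<in> Arr C" "v \<in> Arr C" "Cod C u = Cod C v" "Dom C u = Cod C t"
    "Dom C v = Cod C l" "u \<cdot> t = v \<cdot> l"
  shows "\<exists>!w. w \<in> hom C (Cod C r) (Cod C u) \<and> w \<cdot> r = u \<and> w \<cdot> b = v"
proof -
  have univ: "\<forall>u v. comm_square (op_cat C) u v t l \<longrightarrow>
      (\<exists>!w. w \<in> hom (op_cat C) (Dom (op_cat C) u) (Dom (op_cat C) r) \<and>
        Comp (op_cat C) r w = u \<and> Comp (op_cat C) b w = v)"
    using assms(1) unfolding is_pushout_def is_pullback_def by (rule conjunct2)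
  have "comm_square (op_cat C) u v t l"
    using assms(2-) pushoutD(1,2,5)[OF assms(1)] by (simp add: comm_square_def)
  from univ[rule_format, OF this] show ?thesis unfolding op_simps .
qed

text \<open>By \<open>pullback_copair_along_mono\<close>, the pullback of \<open>[q2, q1]\<close>
  along \<open>q1\<close> has projections \<open>k + 1\<close> and \<open>[k, 1]\<close>. There
  \<open>[f2, f1] (k + 1) = [f2 k, f1] = f1 [k, 1]\<close>, because \<open>f1\<close> and
  \<open>f2\<close> agree on \<open>k\<close>.\<close>

lemma copair_eq_of_equalizer:
  assumes k: "is_pullback C k k q2 q1" and q1: "mono_arr C q1"
    and f: "f1 \<in> Arr C" "f2 \<in> Arr C" "Dom C f1 = Dom C q1" "Dom C f2 = Dom C q1" "Cod C f1 = Cod C f2"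
      "f1 \<cdot> k = f2 \<cdot> k"
    and dom: "Dom C q2 = Dom C q1"
    and y: "y \<in> Arr C" "Cod C y = coprod C (Dom C q1) (Dom C q1)"
    and a: "a \<in> Arr C" "Cod C a = Dom C q1" "Dom C a = Dom C y"
    and eq: "copair C q2 q1 \<cdot> y = q1 \<cdot> a"
  shows "copair C f2 f1 \<cdot> y = f1 \<cdot> a"
proof -
  note kD = pullbackD[OF k]
  have A: "Dom C q1 \<in> Obj C" using kD by simp
  obtain z where z: "z \<in> Arr C" "Dom C z = Dom C a" "Cod C z = coprod C (Dom C k) (Dom C q1)"
    "coprod_arr C k (Ident C (Dom C q1)) \<cdot> z = y" "copair C k (Ident C (Dom C q1)) \<cdot> z = a"
    using pullback_copair_along_mono[OF q1 k, of "Ident C (Dom C q1)" y a] kD dom A y a eq by auto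
  have "copair C f2 f1 \<cdot> (coprod_arr C k (Ident C (Dom C q1)) \<cdot> z) =
      f1 \<cdot> (copair C k (Ident C (Dom C q1)) \<cdot> z)"
    using z(1-3) f kD dom A by simp
  then show ?thesis unfolding z(4,5) .
qed

lemma corelation_cokernel_pair:
  assumes "reflexive_corelation C A Q q1 q2"
  shows "coeffective_equivalence_relation C A Q q1 q2"
proof -
  obtain e where q: "q1 \<in> Arr C" "q2 \<in> Arr C" "Dom C q1 = A" "Dom C q2 = A" "Cod C q1 = Q" "Cod C q2 = Q"
    and epi: "epi_arr C (copair C q1 q2)"
    and e: "e \<in> Arr C" "Dom C e = Q" "Cod C e = A" "e \<cdot> q1 = Ident C A" "e \<cdot> q2 = Ident C A"
    using assms unfolding reflexive_corelation_def by auto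
  have A: "A \<in> Obj C" using q by auto
  let ?q = "copair C q1 q2"
  have re: "regular_epi C ?q" using epi_regular[OF epi] .
  obtain k k' where kk': "is_pullback C k k' q1 q2" using ex_pb[of q1 q2] q by auto
  note kD = pullbackD[OF kk']
  \<comment> \<open>The common retraction \<open>e\<close> of \<open>q1\<close> and
    \<open>q2\<close> forces the two projections to coincide, so this pullback is the equalizer of
    \<open>q1\<close> and \<open>q2\<close>.\<close>
  have "k = k'"
    using reassoc[OF e(4), of k] reassoc[OF e(5), of k'] kD q e by simp
  then have k12: "is_pullback C k k q1 q2" using kk' by simp
  note k21 = pullback_sym[OF k12]
  note kD = pullbackD[OF k12]
  have mono: "mono_arr C q1" "mono_arr C q2"
    using split_mono[of e q1] split_mono[of e q2] q e by simp_all
  obtain s l where sl: "is_pullback C s l q1 ?q" using ex_pb[of q1 ?q] q by auto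
  obtain s' l' where sl': "is_pullback C s' l' q2 ?q" using ex_pb[of q2 ?q] q by auto
  obtain h1 h2 where h: "is_pullback C h1 h2 ?q ?q" using ex_pb[of ?q ?q] q by auto
  note hD = pullbackD(1,2,5-7)[OF h] pullbackD(1,2,5-7)[OF sl] pullbackD(1,2,5-7)[OF sl']
  have hD': "Cod C h1 = coprod C A A" "Cod C h2 = coprod C A A" "Cod C l = coprod C A A"
    "Cod C l' = coprod C A A" "Cod C s = A" "Cod C s' = A" using hD q by simp_all
  \<comment> \<open>The kernel pair \<open>h1, h2\<close> of \<open>[q1, q2]\<close> is covered by
    points of the coproduct of the pullbacks of \<open>[q1, q2]\<close> along \<open>q1\<close> and
    along \<open>q2\<close>, so compatibility need only be tested on these two summands.\<close>
  obtain c d where c: "regular_epi C c" "c \<in> Arr C" "Cod C c = Dom C h1" "d \<in> Arr C" "Dom C d = Dom C c"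
    "Cod C d = coprod C (Dom C s) (Dom C s')" "coprod_arr C s s' \<cdot> d = h1 \<cdot> c" "copair C l l' \<cdot> d = h2 \<cdot> c"
    by (rule cover_copair[OF re sl sl' _ _ _ _ _ pullbackD(9)[OF h]]) (use hD q in simp_all)
  have factor: "\<exists>!w. w \<in> hom C Q (Cod C f1) \<and> w \<cdot> q1 = f1 \<and> w \<cdot> q2 = f2"
    if f: "f1 \<in> Arr C" "f2 \<in> Arr C" "Cod C f1 = Cod C f2" "Dom C f1 = A" "Dom C f2 = A"
      "f1 \<cdot> k = f2 \<cdot> k" for f1 f2
  proof -
    let ?f = "copair C f1 f2"
    let ?s = "copair C (inj_right C A A) (inj_left C A A)"
    \<comment> \<open>\<open>copair_eq_of_equalizer\<close> over \<open>q1\<close> expects the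
      copair \<open>[q2, q1]\<close>, so the summands are first exchanged by \<open>?s\<close>; over
      \<open>q2\<close> the order is already right.\<close>
    have "copair C f2 f1 \<cdot> (?s \<cdot> l) = f1 \<cdot> s"
    proof (rule copair_eq_of_equalizer[OF k21 mono(1)])
      have "copair C q2 q1 \<cdot> (?s \<cdot> l) = copair C q1 q2 \<cdot> l" using q(1-6) A hD hD' by simp
      then show "copair C q2 q1 \<cdot> (?s \<cdot> l) = q1 \<cdot> s" by (simp only: pullbackD(9)[OF sl])
    qed (use f q A hD hD' in simp_all)
    then have 1: "?f \<cdot> l = f1 \<cdot> s" using f(1-5) A hD hD' by simp
    have 2: "?f \<cdot> l' = f2 \<cdot> s'"
      by (rule copair_eq_of_equalizer[OF k12 mono(2) _ _ _ _ _ _ _ _ _ _ _ _ pullbackD(9)[OF sl', symmetric]])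
        (use f q A hD hD' in simp_all)
    have "?f \<cdot> (coprod_arr C s s' \<cdot> d) = ?f \<cdot> (copair C l l' \<cdot> d)"
      using f(1-5) A hD hD' c(4-6) by (simp add: 1 2)
    then have "(?f \<cdot> h1) \<cdot> c = (?f \<cdot> h2) \<cdot> c"
      unfolding c(7,8) using f(1-5) c(2,3) hD hD' by simp
    then have "?f \<cdot> h1 = ?f \<cdot> h2"
      by (rule cover_eq[OF c(1)]) (use f(1-5) c(2,3) hD hD' in simp_all)
    then obtain w where w: "w \<in> Arr C" "Dom C w = Q" "Cod C w = Cod C f1" "w \<cdot> ?q = ?f"
      using regular_epi_factor[OF re h, of ?f] f q by auto
    have "w \<cdot> q1 = (w \<cdot> ?q) \<cdot> inj_left C A A" "w \<cdot> q2 = (w \<cdot> ?q) \<cdot> inj_right C A A"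
      using w(1-3) q A by simp_all
    then have w': "w \<cdot> q1 = f1" "w \<cdot> q2 = f2" unfolding w(4) using f A by simp_all
    show ?thesis
    proof (rule ex1I[of _ w])
      fix w' assume a: "w' \<in> hom C Q (Cod C f1) \<and> w' \<cdot> q1 = f1 \<and> w' \<cdot> q2 = f2"
      have "w' \<cdot> ?q = w \<cdot> ?q" using a w(1-3) w' q by simp
      then show "w' = w" by (rule epiD[OF epi]) (use a w q in simp_all)
    qed (use w w' in simp)
  qed
  have "is_cokernel_pair C k q1 q2"
    unfolding is_cokernel_pair_def
  proof (rule pushoutI)
    fix u v assume uv: "u \<in> Arr C" "v \<in> Arr C" "Cod C u = Cod C v" "Dom C u = Cod C k" "Dom C v = Cod C k"
      "u \<cdot> k = v \<cdot> k"
    then have "\<exists>!w. w \<in> hom C Q (Cod C u) \<and> w \<cdot> q1 = u \<and> w \<cdot> q2 = v"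
      by (intro factor) (use kD(1-7) q in simp_all)
    then show "\<exists>!w. w \<in> hom C (Cod C q1) (Cod C u) \<and> w \<cdot> q1 = u \<and> w \<cdot> q2 = v" by (simp only: q)
  qed (use kD q in simp_all)
  then show ?thesis unfolding coeffective_equivalence_relation_def using q by auto
qed

section \<open>Coexactness\<close>

lemma ex_coequalizer:
  assumes hpo: "has_pushouts_of_regular_epis C" and fg: "f \<in> Arr C" "g \<in> Arr C" "Dom C f = Dom C g" "Cod C f = Cod C g"
  obtains q where "is_coequalizer C f g q"
proof -
  let ?X = "Dom C g"
  have X: "?X \<in> Obj C" using fg by simp
  obtain e m where e: "regular_epi C e" and m: "mono_arr C m" and em: "m \<in> Arr C" "e \<in> Arr C"
    "Dom C m = Cod C e" "Dom C e = coprod C ?X ?X" "Cod C m = Cod C f" "m \<cdot> e = copair C f g"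
    using image_factorization[of "copair C f g"] fg by auto
  let ?d = "copair C (Ident C ?X) (Ident C ?X)" and ?i = "inj_left C ?X ?X" and ?j = "inj_right C ?X ?X"
  have "Dom C e = Dom C ?d" using em(4) X by simp
  then obtain r b where "is_pushout C e ?d r b"
    using hpo codiagonal_regular_epi[OF X] e unfolding has_pushouts_of_regular_epis_def by blast
  note po = this
  have r: "r \<in> Arr C" "b \<in> Arr C" "Dom C r = Cod C e" "Dom C b = ?X" "Cod C r = Cod C b" "r \<cdot> e = b \<cdot> ?d"
    using pushoutD[OF po] X by simp_all
  have "(r \<cdot> e) \<cdot> ?i = b" "(r \<cdot> e) \<cdot> ?j = b" unfolding r(6) using r(1-5) X by simp_all
  then have ri: "r \<cdot> (e \<cdot> ?i) = b" "r \<cdot> (e \<cdot> ?j) = b" using r(1-5) em(1-5) X by simp_all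
  have ed: "h \<cdot> e = (h \<cdot> (e \<cdot> ?i)) \<cdot> ?d"
    if h: "h \<in> Arr C" "Dom C h = Cod C e" "h \<cdot> (e \<cdot> ?i) = h \<cdot> (e \<cdot> ?j)" for h
    by (rule coprod_eqI[of _ _ ?X ?X]) (use h em(1-5) X in simp_all)
  \<comment> \<open>An arrow \<open>h\<close> with \<open>h e i = h e j\<close> has
    \<open>h e\<close> factoring through the codiagonal, so the pushout is the coequalizer of
    \<open>e i\<close> and \<open>e j\<close>. In particular \<open>r\<close> is a regular
    epimorphism and can be pushed out along \<open>m\<close>.\<close>
  have coeq: "is_coequalizer C (e \<cdot> ?i) (e \<cdot> ?j) r"
    unfolding is_coequalizer_def
  proof (intro conjI ballI impI)
    fix h assume "h \<in> Arr C" "Dom C h = Cod C (e \<cdot> ?i) \<and> h \<cdot> (e \<cdot> ?i) = h \<cdot> (e \<cdot> ?j)"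
    then have h: "h \<in> Arr C" "Dom C h = Cod C e" "h \<cdot> (e \<cdot> ?i) = h \<cdot> (e \<cdot> ?j)" using em X by simp_all
    have ex1: "\<exists>!w. w \<in> hom C (Cod C r) (Cod C h) \<and> w \<cdot> r = h \<and> w \<cdot> b = h \<cdot> (e \<cdot> ?i)"
      by (rule pushout_univ[OF po _ _ _ _ _ ed[OF h]]) (use h(1,2) em(1-5) X in simp_all)
    have wb: "w \<cdot> b = h \<cdot> (e \<cdot> ?i)" if w: "w \<in> hom C (Cod C r) (Cod C h)" "w \<cdot> r = h" for w
      using reassoc[OF w(2), of "e \<cdot> ?i"] ri(1) w(1) r(1-5) em(1-5) X by simp
    show "\<exists>!w. w \<in> hom C (Cod C r) (Cod C h) \<and> w \<cdot> r = h"
      using ex1 wb by metis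
  qed (use r(1-5) ri em(1-5) X in simp_all)
  then have rr: "regular_epi C r" unfolding regular_epi_def by blast
  have dom: "Dom C r = Dom C m" using r(3) em(3) by simp
  obtain q b' where q: "q \<in> Arr C" "Dom C q = Cod C m" "b' \<in> Arr C" "Dom C b' = Cod C r" "Cod C b' = Cod C q"
    "q \<cdot> m = b' \<cdot> r"
    and unq: "\<And>f g. f \<in> Arr C \<Longrightarrow> g \<in> Arr C \<Longrightarrow> Dom C f = Cod C m \<Longrightarrow> Dom C g = Cod C r \<Longrightarrow> Cod C f = Cod C g \<Longrightarrow>
      f \<cdot> m = g \<cdot> r \<Longrightarrow> \<exists>!k. k \<in> hom C (Cod C q) (Cod C f) \<and> k \<cdot> q = f \<and> k \<cdot> b' = g"
    by (rule pushout_mono_regular_epi[OF m rr dom]) (rule that)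
  have "(m \<cdot> e) \<cdot> ?i = f" "(m \<cdot> e) \<cdot> ?j = g" unfolding em(6) using fg X by simp_all
  then have f: "m \<cdot> (e \<cdot> ?i) = f" and g: "m \<cdot> (e \<cdot> ?j) = g" using em(1-5) X by simp_all
  have "is_coequalizer C f g q"
    unfolding is_coequalizer_def
  proof (intro conjI ballI impI)
    have "q \<cdot> (m \<cdot> (e \<cdot> ?i)) = b' \<cdot> (r \<cdot> (e \<cdot> ?i))" "q \<cdot> (m \<cdot> (e \<cdot> ?j)) = b' \<cdot> (r \<cdot> (e \<cdot> ?j))"
      using reassoc[OF q(6), of "e \<cdot> ?i"] reassoc[OF q(6), of "e \<cdot> ?j"] q(1-5) r(1-5) em(1-5) X by simp_all
    then show "q \<cdot> f = q \<cdot> g" by (simp only: f g ri)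
  next
    fix h assume "h \<in> Arr C" "Dom C h = Cod C f \<and> h \<cdot> f = h \<cdot> g"
    then have h: "h \<in> Arr C" "Dom C h = Cod C m" "h \<cdot> f = h \<cdot> g" using em by simp_all
    have "(h \<cdot> m) \<cdot> (e \<cdot> ?i) = (h \<cdot> m) \<cdot> (e \<cdot> ?j)" using h em(1-5) X by (simp add: f g)
    then obtain k where k: "k \<in> Arr C" "Dom C k = Cod C r" "Cod C k = Cod C h" "k \<cdot> r = h \<cdot> m"
      using coequalizerE[OF coeq, of "h \<cdot> m"] h em(1-5) r(1-5) by auto
    have ex1: "\<exists>!l. l \<in> hom C (Cod C q) (Cod C h) \<and> l \<cdot> q = h \<and> l \<cdot> b' = k"
      by (rule unq) (use h k in simp_all)
    \<comment> \<open>The coequalizer property prescribes only \<open>l q = h\<close>; the second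
      pushout equation then follows by cancelling \<open>r\<close>.\<close>
    have "l \<cdot> b' = k" if l: "l \<in> hom C (Cod C q) (Cod C h)" "l \<cdot> q = h" for l
    proof (rule cover_eq[OF rr])
      show "(l \<cdot> b') \<cdot> r = k \<cdot> r"
        using reassoc[OF l(2), of m] l(1) q k(4) em(1-5) r(1-5) by simp
    qed (use l(1) q(1-5) k(1-3) in simp_all)
    with ex1 show "\<exists>!l. l \<in> hom C (Cod C q) (Cod C h) \<and> l \<cdot> q = h" by metis
  qed (use q(1-5) fg em(1-5) in simp_all)
  then show thesis by (rule that)
qed

text \<open>The usual construction of a colimit in \<open>C\<close> as the coequalizer of two arrows
  between coproducts, one indexed by the arrows of \<open>J\<close> and one by its objects.\<close>

lemma op_finitely_complete:
  assumes po: "has_pushouts_of_regular_epis C"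
  shows "finitely_complete (op_cat C)"
  unfolding finitely_complete_def
proof (intro allI impI)
  fix J :: "(nat, nat) cat" and Fo Fa
  assume J: "category J \<and> finite (Obj J) \<and> finite (Arr J) \<and> is_functor J (op_cat C) Fo Fa"
  interpret J: category J using J by simp
  have Fo: "Fo j \<in> Obj C" if "j \<in> Obj J" for j
    using J that unfolding is_functor_def by simp
  have Fa: "Fa h \<in> Arr C" "Dom C (Fa h) = Fo (Cod J h)" "Cod C (Fa h) = Fo (Dom J h)" if "h \<in> Arr J" for h
    using J that unfolding is_functor_def by auto
  obtain S \<iota> where S: "S \<in> Obj C" "\<forall>i\<in>Obj J. \<iota> i \<in> hom C (Fo i) S"
    "\<forall>X\<in>Obj C. \<forall>f. (\<forall>i\<in>Obj J. f i \<in> hom C (Fo i) X) \<longrightarrow> (\<exists>!h. h \<in> hom C S X \<and> (\<forall>i\<in>Obj J. h \<cdot> \<iota> i = f i))"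
    using finite_limits_coproducts(2)[unfolded has_finite_coproducts_def, rule_format, of "Obj J" Fo] J Fo by auto
  \<comment> \<open>The summand at \<open>h\<close> is the value at the codomain of
    \<open>h\<close>: a functor into the opposite category turns \<open>h\<close> into an arrow of
    \<open>C\<close> starting there.\<close>
  obtain T \<kappa> where T: "T \<in> Obj C" "\<forall>i\<in>Arr J. \<kappa> i \<in> hom C (Fo (Cod J i)) T"
    "\<forall>X\<in>Obj C. \<forall>f. (\<forall>i\<in>Arr J. f i \<in> hom C (Fo (Cod J i)) X) \<longrightarrow>
      (\<exists>!h. h \<in> hom C T X \<and> (\<forall>i\<in>Arr J. h \<cdot> \<kappa> i = f i))"
    using finite_limits_coproducts(2)[unfolded has_finite_coproducts_def, rule_format, of "Arr J" "\<lambda>h. Fo (Cod J h)"]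
      J Fo by auto
  have \<iota>: "\<iota> i \<in> Arr C" "Dom C (\<iota> i) = Fo i" "Cod C (\<iota> i) = S" if "i \<in> Obj J" for i using S(2) that by auto
  have \<kappa>: "\<kappa> i \<in> Arr C" "Dom C (\<kappa> i) = Fo (Cod J i)" "Cod C (\<kappa> i) = T" if "i \<in> Arr J" for i
    using T(2) that by auto
  have "\<forall>i\<in>Arr J. \<iota> (Cod J i) \<in> hom C (Fo (Cod J i)) S" using \<iota> by simp
  then obtain u where u: "u \<in> hom C T S" "\<And>h. h \<in> Arr J \<Longrightarrow> u \<cdot> \<kappa> h = \<iota> (Cod J h)"
    using T(3)[rule_format, OF S(1), of "\<lambda>h. \<iota> (Cod J h)"] by blast
  have "\<forall>h\<in>Arr J. \<iota> (Dom J h) \<cdot> Fa h \<in> hom C (Fo (Cod J h)) S" using \<iota> Fa by simp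
  then obtain v where v: "v \<in> hom C T S" "\<And>h. h \<in> Arr J \<Longrightarrow> v \<cdot> \<kappa> h = \<iota> (Dom J h) \<cdot> Fa h"
    using T(3)[rule_format, OF S(1), of "\<lambda>h. \<iota> (Dom J h) \<cdot> Fa h"] by blast
  obtain e where e: "is_coequalizer C u v e"
    using ex_coequalizer[OF po, of u v] u v by auto
  have e': "e \<in> Arr C" "Dom C e = S" "e \<cdot> u = e \<cdot> v" using e u by (auto simp: is_coequalizer_def)
  have "is_limit J (op_cat C) Fo Fa (Cod C e) (\<lambda>j. e \<cdot> \<iota> j)"
    unfolding is_limit_def
  proof (intro conjI allI impI)
    have "(e \<cdot> \<iota> (Dom J h)) \<cdot> Fa h = e \<cdot> \<iota> (Cod J h)" if h: "h \<in> Arr J" for h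
    proof -
      have "(e \<cdot> u) \<cdot> \<kappa> h = (e \<cdot> v) \<cdot> \<kappa> h" by (simp only: e'(3))
      moreover have "(e \<cdot> u) \<cdot> \<kappa> h = e \<cdot> \<iota> (Cod J h)"
        using e'(1,2) u(1) \<kappa>[OF h] by (simp add: u(2)[OF h])
      moreover have "(e \<cdot> v) \<cdot> \<kappa> h = e \<cdot> (\<iota> (Dom J h) \<cdot> Fa h)"
        using e'(1,2) v(1) \<kappa>[OF h] by (simp add: v(2)[OF h])
      ultimately show ?thesis using e'(1,2) \<iota>[of "Dom J h"] Fa[OF h] h by simp
    qed
    then show "is_cone J (op_cat C) Fo Fa (Cod C e) (\<lambda>j. e \<cdot> \<iota> j)"
      unfolding is_cone_def using e' \<iota> by simp
  next
    fix Y \<psi> assume cone: "is_cone J (op_cat C) Fo Fa Y \<psi>"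
    then have Y: "Y \<in> Obj C" and \<psi>: "\<forall>j\<in>Obj J. \<psi> j \<in> hom C (Fo j) Y"
      and \<psi>F: "\<And>h. h \<in> Arr J \<Longrightarrow> \<psi> (Dom J h) \<cdot> Fa h = \<psi> (Cod J h)"
      unfolding is_cone_def by auto
    obtain g where g: "g \<in> hom C S Y" "\<And>j. j \<in> Obj J \<Longrightarrow> g \<cdot> \<iota> j = \<psi> j"
      and guniq: "\<And>g'. g' \<in> hom C S Y \<Longrightarrow> \<forall>j\<in>Obj J. g' \<cdot> \<iota> j = \<psi> j \<Longrightarrow> g' = g"
      using S(3)[rule_format, OF Y, of \<psi>] \<psi> by blast
    have gu: "(g \<cdot> u) \<cdot> \<kappa> h = \<psi> (Cod J h)" if h: "h \<in> Arr J" for h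
      using g u(1) \<kappa>[OF h] h by (simp add: u(2))
    have gv: "(g \<cdot> v) \<cdot> \<kappa> h = \<psi> (Cod J h)" if h: "h \<in> Arr J" for h
    proof -
      have "(g \<cdot> v) \<cdot> \<kappa> h = (g \<cdot> \<iota> (Dom J h)) \<cdot> Fa h"
        using g(1) v(1) \<kappa>[OF h] h \<iota>[of "Dom J h"] Fa[OF h] by (simp add: v(2))
      then show ?thesis using g(2)[of "Dom J h"] \<psi>F[OF h] h by simp
    qed
    have "\<forall>h\<in>Arr J. \<psi> (Cod J h) \<in> hom C (Fo (Cod J h)) Y" using \<psi> by simp
    then have "\<exists>!t. t \<in> hom C T Y \<and> (\<forall>h\<in>Arr J. t \<cdot> \<kappa> h = \<psi> (Cod J h))"
      using T(3)[rule_format, OF Y, of "\<lambda>h. \<psi> (Cod J h)"] by blast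
    moreover have "g \<cdot> u \<in> hom C T Y" "g \<cdot> v \<in> hom C T Y" using g(1) u(1) v(1) by simp_all
    ultimately have "g \<cdot> u = g \<cdot> v" using gu gv by blast
    then obtain w where w: "w \<in> Arr C" "Dom C w = Cod C e" "Cod C w = Y" "w \<cdot> e = g"
      using coequalizerE[OF e, of g] g(1) e' by auto
    have we: "w' \<cdot> (e \<cdot> \<iota> j) = (w' \<cdot> e) \<cdot> \<iota> j" if "w' \<in> hom C (Cod C e) Y" "j \<in> Obj J" for w' j
      using that e' \<iota> by simp
    have "\<exists>!w. w \<in> hom C (Cod C e) Y \<and> (\<forall>j\<in>Obj J. w \<cdot> (e \<cdot> \<iota> j) = \<psi> j)"
    proof (rule ex1I[of _ w])
      show "w \<in> hom C (Cod C e) Y \<and> (\<forall>j\<in>Obj J. w \<cdot> (e \<cdot> \<iota> j) = \<psi> j)"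
        using w(1-3) we[of w] w(4) g(2) by simp
      fix w' assume a: "w' \<in> hom C (Cod C e) Y \<and> (\<forall>j\<in>Obj J. w' \<cdot> (e \<cdot> \<iota> j) = \<psi> j)"
      then have "w' \<cdot> e = g" using e' we[of w'] by (intro guniq) simp_all
      then have "w' \<cdot> e = w \<cdot> e" by (simp only: w(4))
      then show "w' = w" by (rule epiD[OF coequalizer_epi[OF e]]) (use a w in simp_all)
    qed
    then show "\<exists>!w. w \<in> hom (op_cat C) Y (Cod C e) \<and>
        (\<forall>j\<in>Obj J. Comp (op_cat C) (e \<cdot> \<iota> j) w = \<psi> j)"
      by (simp only: op_simps)
  qed
  then show "\<exists>X \<phi>. is_limit J (op_cat C) Fo Fa X \<phi>" by blast
qed

text \<open>This is \<open>mono_equalizer\<close> read in the opposite category. Together with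
  \<open>op_regular_epi_mono\<close> it identifies the regular epimorphisms there with the
  monomorphisms of \<open>C\<close>.\<close>

lemma mono_op_regular_epi:
  assumes m: "mono_arr C m"
  shows "regular_epi (op_cat C) m"
proof -
  have mA: "m \<in> Arr C" using m by (simp add: mono_arr_def)
  obtain q1 q2 where q: "q1 \<in> Arr C" "q2 \<in> Arr C" "Dom C q1 = Cod C m" "Dom C q2 = Cod C m"
    "Cod C q1 = Cod C q2" "q1 \<cdot> m = q2 \<cdot> m"
    and eq: "\<And>x. x \<in> Arr C \<Longrightarrow> Cod C x = Cod C m \<Longrightarrow> q1 \<cdot> x = q2 \<cdot> x \<Longrightarrow>
      \<exists>z. z \<in> hom C (Dom C x) (Dom C m) \<and> m \<cdot> z = x"
    by (rule mono_equalizer[OF m]) (rule that)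
  have "is_coequalizer (op_cat C) q1 q2 m"
    unfolding is_coequalizer_def op_simps
  proof (intro conjI ballI impI)
    fix h assume h: "h \<in> Arr C" "Cod C h = Dom C q1 \<and> q1 \<cdot> h = q2 \<cdot> h"
    then obtain z where z: "z \<in> hom C (Dom C h) (Dom C m) \<and> m \<cdot> z = h" using eq[of h] q by auto
    show "\<exists>!k. k \<in> hom C (Dom C h) (Dom C m) \<and> m \<cdot> k = h"
    proof (rule ex1I)
      show "z \<in> hom C (Dom C h) (Dom C m) \<and> m \<cdot> z = h" by fact
      fix k assume "k \<in> hom C (Dom C h) (Dom C m) \<and> m \<cdot> k = h"
      with z show "k = z" by - (rule monoD[OF m], simp_all)
    qed
  qed (use q mA in simp_all)
  then show ?thesis unfolding regular_epi_def by blast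
qed

lemma op_regular_epi_mono:
  assumes "regular_epi (op_cat C) m"
  shows "mono_arr C m"
proof -
  have "category (op_cat C)" using category_axioms by (rule category_op_cat)
  then have "epi_arr (op_cat C) m" using assms by (rule category.regular_epi_epi)
  then show ?thesis unfolding epi_arr_def mono_arr_def op_simps .
qed

text \<open>An arbitrary \<open>b\<close> is replaced by the split epimorphism
  \<open>[b, 1]\<close>, and \<open>r\<close> by \<open>r + 1\<close>. Gluing these yields a mono
  \<open>b'\<close>, and the pushout property gives \<open>w\<close> with \<open>w l = b'\<close>,
  so \<open>l\<close> is mono.\<close>

lemma pushout_mono:
  assumes po: "is_pushout C r b t l" and r: "mono_arr C r"
  shows "mono_arr C l"
proof -
  have a: "r \<in> Arr C" "b \<in> Arr C" "t \<in> Arr C" "l \<in> Arr C" "Dom C r = Dom C b" "Cod C r = Dom C t"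
    "Cod C b = Dom C l" "Cod C t = Cod C l" "t \<cdot> r = l \<cdot> b"
    using pushoutD[OF po] by simp_all
  let ?B = "Dom C l" and ?A = "Dom C t"
  let ?m = "coprod_arr C r (Ident C ?B)" and ?p = "copair C b (Ident C ?B)"
  have o: "?A \<in> Obj C" "?B \<in> Obj C" "Dom C b \<in> Obj C" using a by simp_all
  have "mono_arr C (Ident C ?B)" using o by (intro mono_ident)
  then have m: "mono_arr C ?m" by (rule mono_coprod_arr[OF r])
  have p: "regular_epi C ?p"
    by (rule split_epi_regular[of _ "inj_right C (Dom C b) ?B"]) (use a o in simp_all)
  have dom: "Dom C ?p = Dom C ?m" using a o by simp
  obtain q b' where q: "q \<in> Arr C" "Dom C q = Cod C ?m" "b' \<in> Arr C" "Dom C b' = Cod C ?p" "Cod C b' = Cod C q"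
    "q \<cdot> ?m = b' \<cdot> ?p" and b': "mono_arr C b'"
    by (rule pushout_mono_regular_epi[OF m p dom]) (rule that)
  have q': "Dom C q = coprod C ?A ?B" "Dom C b' = ?B" using q a o by simp_all
  have "(q \<cdot> ?m) \<cdot> inj_left C (Dom C b) ?B = (b' \<cdot> ?p) \<cdot> inj_left C (Dom C b) ?B" by (simp only: q(6))
  then have "(q \<cdot> inj_left C ?A ?B) \<cdot> r = b' \<cdot> b" using q(1,3,5) q' a o by simp
  then obtain w where w: "w \<in> Arr C" "Dom C w = Cod C l" "Cod C w = Cod C q" "w \<cdot> l = b'"
    using pushout_univ[OF po, of "q \<cdot> inj_left C ?A ?B" b'] q(1,3,5) q' a o by auto
  show ?thesis unfolding mono_arr_def
  proof (intro conjI allI impI)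
    fix x y assume xy: "x \<in> Arr C \<and> y \<in> Arr C \<and> Dom C x = Dom C y \<and> Cod C x = Dom C l \<and>
      Cod C y = Dom C l \<and> l \<cdot> x = l \<cdot> y"
    have "b' \<cdot> x = b' \<cdot> y"
      using reassoc[OF w(4), of x] reassoc[OF w(4), of y] xy w a by simp
    then show "x = y" by (rule monoD[OF b']) (use xy q' in simp_all)
  qed (rule a)
qed

lemma op_regular:
  assumes hpo: "has_pushouts_of_regular_epis C"
  shows "regular_category (op_cat C)"
  unfolding regular_category_def
proof (intro conjI allI impI)
  show "category (op_cat C)" using category_axioms by (rule category_op_cat)
  show "finitely_complete (op_cat C)" by (rule op_finitely_complete[OF hpo])
next
  fix f r1 r2 assume "is_kernel_pair (op_cat C) f r1 r2"
  then have po: "is_pushout C f f r1 r2" by (simp only: is_kernel_pair_def is_pushout_def)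
  have a: "f \<in> Arr C" "r1 \<in> Arr C" "r2 \<in> Arr C" "Cod C f = Dom C r1" "Dom C r2 = Dom C r1" "Cod C r1 = Cod C r2"
    using pushoutD[OF po] by simp_all
  let ?A = "Dom C r1"
  \<comment> \<open>A cokernel pair has a common retraction, so the two projections of the pullback
    of \<open>r1\<close> and \<open>r2\<close> coincide and give an equalizer, that is, a
    coequalizer in the opposite category.\<close>
  obtain w where w: "w \<in> Arr C" "Dom C w = Cod C r1" "Cod C w = ?A" "w \<cdot> r1 = Ident C ?A" "w \<cdot> r2 = Ident C ?A"
    using pushout_univ[OF po, of "Ident C ?A" "Ident C ?A"] a by auto
  obtain k k' where k: "is_pullback C k k' r1 r2" using ex_pb[of r1 r2] a by auto
  note kD = pullbackD[OF k]
  have kk': "k = k'"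
    using reassoc[OF w(4), of k] reassoc[OF w(5), of k'] kD a w by simp
  have "is_coequalizer (op_cat C) r1 r2 k"
    unfolding is_coequalizer_def op_simps
  proof (intro conjI ballI impI)
    fix h assume h: "h \<in> Arr C" "Cod C h = Dom C r1 \<and> r1 \<cdot> h = r2 \<cdot> h"
    obtain z where z: "z \<in> Arr C" "Dom C z = Dom C h" "Cod C z = Dom C k'" "k \<cdot> z = h"
      using pullbackE[OF k, of h h] h a by auto
    show "\<exists>!z. z \<in> hom C (Dom C h) (Dom C k) \<and> k \<cdot> z = h"
    proof (rule ex1I)
      show "z \<in> hom C (Dom C h) (Dom C k) \<and> k \<cdot> z = h" using z kD by simp
      fix z' assume "z' \<in> hom C (Dom C h) (Dom C k) \<and> k \<cdot> z' = h"
      with z kD kk' show "z' = z" by - (rule pullback_eq[OF k], simp_all)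
    qed
  qed (use kD kk' a in simp_all)
  then show "\<exists>e. is_coequalizer (op_cat C) r1 r2 e" by blast
next
  fix t l r b assume a: "is_pullback (op_cat C) t l r b \<and> regular_epi (op_cat C) r"
  \<comment> \<open>Stability of regular epimorphisms in the opposite category becomes stability of
    monomorphisms of \<open>C\<close> under pushout.\<close>
  then have "is_pushout C r b t l" by (simp only: is_pushout_def)
  then show "regular_epi (op_cat C) l"
    using a op_regular_epi_mono pushout_mono mono_op_regular_epi by blast
qed

text \<open>Joint monicity and reflexivity in the opposite category describe a reflexive corelation
  in \<open>C\<close>, so effectiveness comes from \<open>corelation_cokernel_pair\<close>.\<close>

lemma coexact:
  assumes po: "has_pushouts_of_regular_epis C"
  shows "coexact_category C"
  unfolding coexact_category_def exact_category_def
proof (intro conjI allI impI)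
  show "regular_category (op_cat C)" by (rule op_regular[OF po])
  fix A R r1 r2 assume "internal_equivalence_relation (op_cat C) A R r1 r2"
  then have r: "r1 \<in> hom C A R" "r2 \<in> hom C A R" "jointly_monic (op_cat C) r1 r2"
    "\<exists>d\<in>hom C R A. d \<cdot> r1 = Ident C A \<and> d \<cdot> r2 = Ident C A"
    unfolding internal_equivalence_relation_def op_simps by blast+
  have R: "Cod C r1 = R" using r(1) by simp
  have je: "\<forall>u v. u \<in> Arr C \<and> v \<in> Arr C \<and> Cod C u = Cod C v \<and> Dom C u = R \<and> Dom C v = R \<and>
      u \<cdot> r1 = v \<cdot> r1 \<and> u \<cdot> r2 = v \<cdot> r2 \<longrightarrow> u = v"
    using r(3) unfolding jointly_monic_def op_simps R by (elim conjE)
  have "epi_arr C (copair C r1 r2)"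
    unfolding epi_arr_def
  proof (intro conjI allI impI)
    fix u v assume uv: "u \<in> Arr C \<and> v \<in> Arr C \<and> Cod C u = Cod C v \<and> Dom C u = Cod C (copair C r1 r2) \<and>
      Dom C v = Cod C (copair C r1 r2) \<and> u \<cdot> copair C r1 r2 = v \<cdot> copair C r1 r2"
    then have uv': "u \<in> Arr C" "v \<in> Arr C" "Cod C u = Cod C v" "Dom C u = R" "Dom C v = R"
      using r(1,2) by simp_all
    have A: "A \<in> Obj C" using r(1) by auto
    have "(u \<cdot> copair C r1 r2) \<cdot> inj_left C A A = (v \<cdot> copair C r1 r2) \<cdot> inj_left C A A"
      "(u \<cdot> copair C r1 r2) \<cdot> inj_right C A A = (v \<cdot> copair C r1 r2) \<cdot> inj_right C A A"
      using uv by simp_all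
    then have "u \<cdot> r1 = v \<cdot> r1" "u \<cdot> r2 = v \<cdot> r2" using uv' r(1,2) A by simp_all
    then show "u = v" using uv' by (intro je[rule_format]) simp
  qed (use r(1,2) in simp)
  then have "reflexive_corelation C A R r1 r2"
    unfolding reflexive_corelation_def using r by blast
  then show "\<exists>f. is_kernel_pair (op_cat C) f r1 r2"
    using corelation_cokernel_pair
    unfolding coeffective_equivalence_relation_def is_cokernel_pair_def is_pushout_def is_kernel_pair_def by blast
qed

end

theorem proposition4p10:
  fixes C :: "('o, 'm) cat"
  assumes "exact_category C"
    and "condition_P C"
  shows "(\<forall>A Q q1 q2. reflexive_corelation C A Q q1 q2 \<longrightarrow>
            coeffective_equivalence_relation C A Q q1 q2) \<and>
         (has_pushouts_of_regular_epis C \<longrightarrow> coexact_category C)"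
proof -
  interpret exact_category_P C
    using assms by (simp add: exact_category_P_def exact_category_P_axioms_def condition_P_def)
  show ?thesis using corelation_cokernel_pair coexact by blast
qed

end
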